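(* Let $m\ge n$ be integers and let $V$ be an orthogonal $m\times m$ matrix with rows $v_1,\dots,v_m\in\mathbb{R}^m$. For each $i$ let $w_i\in\mathbb{R}^{m-n}$ be the vector of the last $m-n$ coordinates of $v_i$, and let $M$ be the $(m-n)\times m$ matrix whose $i$-th column is $w_i$ (so $M\,\mathrm{diag}(\lambda_i)\,{}^tM=\sum_i\lambda_iw_i\otimes w_i$). Let $r>1$ and $p_1,\dots,p_m>1$ satisfy $\sum_{i=1}^m1/p_i=n+(m-n)/r$, and let $D=D_{r,p_i}\ge0$ be the largest constant such that for all positive $\lambda_1,\dots,\lambda_m$, $$\det\big(M\,\mathrm{diag}(\lambda_i)\,{}^tM\big)\ge D\prod_{i=1}^m\lambda_i^{r'/p_i'}.$$ Then for all continuous positive integrable functions $f_1,\dots,f_m$ and $F_1,\dots,F_m$ on $\mathbb{R}$ with $\int f_i=\int F_i$ for every $i$, $$\Big[\int_{\mathbb{R}^{m-n}}\Big[\int_{\mathbb{R}^n}\prod_{i=1}^m f_i^{1/p_i}(\langle x,v_i\rangle)\,dx_1\cdots dx_n\Big]^r dx_{n+1}\cdots dx_m\Big]^{1/r}\le D^{-1/r'}\int_{\mathbb{R}^n}\Big[\int_{\mathbb{R}^{m-n}}\prod_{i=1}^m F_i^{r/p_i}(\langle X,v_i\rangle)\,dX_{n+1}\cdots dX_m\Big]^{1/r}dX_1\cdots dX_n,$$ where $x=(x_1,\dots,x_m)$, $X=(X_1,\dots,X_m)$, and $D^{-1/r'}=+\infty$ if $D=0$.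
   Context: For $t>1$, the conjugate exponent $t'$ is defined by $1/t+1/t'=1$. $\mathrm{diag}(\lambda_i)$ is the $m\times m$ diagonal matrix with entries $\lambda_1,\dots,\lambda_m$; ${}^tM$ is the transpose of $M$; $w\otimes w=ww^T$. *)

theory Defs
  imports "HOL-Analysis.Analysis" "Jordan_Normal_Form.Determinant"
begin

definition enn_powr :: "ennreal \<Rightarrow> real \<Rightarrow> ennreal" where
  "enn_powr x a = (if x = \<infinity> then \<infinity> else ennreal (enn2real x powr a))"

definition conj_exp :: "real \<Rightarrow> real" where
  "conj_exp t = t / (t - 1)"

text \<open>The (m-n) x m matrix M whose i-th column is w_i, the last m-n coordinates of the
  i-th row of V (0-based indices: coordinates n..m-1).\<close>
definition Wmat :: "nat \<Rightarrow> nat \<Rightarrow> real Matrix.mat \<Rightarrow> real Matrix.mat" where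
  "Wmat m n V = Matrix.mat (m - n) m (\<lambda>(a, i). V $$ (i, n + a))"

definition diag_of :: "nat \<Rightarrow> (nat \<Rightarrow> real) \<Rightarrow> real Matrix.mat" where
  "diag_of m l = Matrix.mat m m (\<lambda>(i, j). if i = j then l i else 0)"

definition gram_det :: "nat \<Rightarrow> nat \<Rightarrow> real Matrix.mat \<Rightarrow> (nat \<Rightarrow> real) \<Rightarrow> real" where
  "gram_det m n V l = Determinant.det (Wmat m n V * diag_of m l * transpose_mat (Wmat m n V))"

definition det_ineq :: "nat \<Rightarrow> nat \<Rightarrow> real Matrix.mat \<Rightarrow> real \<Rightarrow> (nat \<Rightarrow> real) \<Rightarrow> real \<Rightarrow> bool" where
  "det_ineq m n V r p D \<longleftrightarrow> (\<forall>l. (\<forall>i<m. l i > 0) \<longrightarrow>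
      gram_det m n V l \<ge> D * (\<Prod>i<m. l i powr (conj_exp r / conj_exp (p i))))"

definition best_const :: "nat \<Rightarrow> nat \<Rightarrow> real Matrix.mat \<Rightarrow> real \<Rightarrow> (nat \<Rightarrow> real) \<Rightarrow> real \<Rightarrow> bool" where
  "best_const m n V r p D \<longleftrightarrow> D \<ge> 0 \<and> det_ineq m n V r p D \<and>
      (\<forall>D'. D' \<ge> 0 \<and> det_ineq m n V r p D' \<longrightarrow> D' \<le> D)"

text \<open>Gluing x' (coordinates 0..n-1) and x'' (coordinates n..m-1) into one vector.\<close>
definition glue :: "nat \<Rightarrow> (nat \<Rightarrow> real) \<Rightarrow> (nat \<Rightarrow> real) \<Rightarrow> nat \<Rightarrow> real" where
  "glue n x y k = (if k < n then x k else y k)"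

definition ip_row :: "nat \<Rightarrow> real Matrix.mat \<Rightarrow> nat \<Rightarrow> (nat \<Rightarrow> real) \<Rightarrow> real" where
  "ip_row m V i x = (\<Sum>k<m. x k * V $$ (i, k))"

end

theory Submission
  imports Defs
begin

text \<open>
  Let \<open>u\<^sub>i\<close> be the increasing map that transports \<open>F\<^sub>i dt\<close> to \<open>f\<^sub>i dt\<close>, so that \<open>u\<^sub>i' f\<^sub>i(u\<^sub>i) = F\<^sub>i\<close>.
  With \<open>K(y)\<close> the inner integral on the left, the \<open>r\<close>-th power of the left-hand side is the integral over
  all of space of the product of the \<open>f\<^sub>i^(1/p\<^sub>i)\<close> times \<open>K^(r-1)\<close>. Substitute \<open>x = V\<^sup>T u(V X)\<close>, whose
  Jacobian is the product of the \<open>u\<^sub>i'\<close>, and apply Hoelder's inequality in the last \<open>m - n\<close> variables. The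
  second factor contains the product of the \<open>u\<^sub>i'\<close> to the powers \<open>r'/p\<^sub>i'\<close>, which is at most \<open>1/D\<close> times
  the Jacobian \<open>det (M diag(u\<^sub>i') M\<^sup>T)\<close> of the injective map sending the last variables of \<open>X\<close> to those of
  \<open>x\<close>. Hence this factor is bounded by \<open>D^(-1/r')\<close> times the \<open>r'\<close>-norm of \<open>K^(r-1)\<close>, and one divides by
  the latter, after truncating \<open>K\<close> to make it finite.
\<close>

section \<open>Linear substitutions in finite products of the Lebesgue measure\<close>

text \<open>Both sides integrate over the same rotated copy of R^m, but in opposite orders: the left
  side has the last coordinates outside, the right side the first ones. Testing K (the function
  \<open>marginal\<close>) against a function \<open>h\<close> of the last coordinates turns the
  left side into one integral over R^m, where the order is free; this is why the argument goes
  through duality. The exponents fit because u_i' f_i(u_i)^(1/p_i) = F_i^(1/p_i) (u_i')^(1/p_i'),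
  and Hoelder's inequality raises the surplus (u_i')^(1/p_i') to the power r', which produces the
  exponents in the definition of D. For D > 0 that definition also makes the Jacobian positive.
  Along a fibre only an upper bound for the transported integral is needed, so injectivity of the
  fibre map suffices and its image need not be known. That bound is obtained by approximation, so
  the test function has to be lower semicontinuous; this shapes the truncation of K from which
  \<open>h\<close> is built.\<close>

abbreviation leb :: "nat set \<Rightarrow> (nat \<Rightarrow> real) measure" where
  "leb I \<equiv> Pi\<^sub>M I (\<lambda>_. lborel)"

interpretation leb: product_sigma_finite "\<lambda>_::nat. lborel :: real measure"
  by standard

text \<open>Both measures agree on boxes, where the integral of a product factors into
  one-dimensional integrals, and a finite product measure is determined by its boxes. The hypothesis
  \<open>sub\<close> is a push-forward identity on each line, so the same lemma serves translations
  and transport maps.\<close>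

lemma nn_integral_leb_substitution:
  fixes T :: "nat \<Rightarrow> real \<Rightarrow> real" and w :: "nat \<Rightarrow> real \<Rightarrow> ennreal"
  assumes fin: "finite I"
    and T [measurable]: "\<And>i. i \<in> I \<Longrightarrow> T i \<in> borel_measurable borel"
    and w [measurable]: "\<And>i. i \<in> I \<Longrightarrow> w i \<in> borel_measurable borel"
    and sub: "\<And>i. i \<in> I \<Longrightarrow> distr (density lborel (w i)) borel (T i) = lborel"
    and g [measurable]: "g \<in> borel_measurable (leb I)"
  shows "(\<integral>\<^sup>+x. (\<Prod>i\<in>I. w i (x i)) * g (\<lambda>i\<in>I. T i (x i)) \<partial>leb I) = (\<integral>\<^sup>+x. g x \<partial>leb I)"
proof -
  define S where "S = (\<lambda>x. \<lambda>i\<in>I. T i (x i))"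
  define W where "W = (\<lambda>x::nat \<Rightarrow> real. \<Prod>i\<in>I. w i (x i))"
  have S[measurable]: "S \<in> leb I \<rightarrow>\<^sub>M leb I"
    unfolding S_def by measurable
  have W[measurable]: "W \<in> borel_measurable (leb I)"
    unfolding W_def by measurable
  have eq: "distr (density (leb I) W) (leb I) S = leb I"
  proof (rule leb.PiM_eqI[OF fin])
    fix A :: "nat \<Rightarrow> real set" assume A: "\<And>i. i \<in> I \<Longrightarrow> A i \<in> sets lborel"
    then have A'[measurable]: "\<And>i. i \<in> I \<Longrightarrow> A i \<in> sets borel" by simp
    have PA: "Pi\<^sub>E I A \<in> sets (leb I)"
      using A fin by (intro sets_PiM_I_finite) auto
    have "emeasure (distr (density (leb I) W) (leb I) S) (Pi\<^sub>E I A)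
        = (\<integral>\<^sup>+x. indicator (Pi\<^sub>E I A) x \<partial>(distr (density (leb I) W) (leb I) S))"
      using PA by simp
    also have "\<dots> = (\<integral>\<^sup>+x. W x * indicator (Pi\<^sub>E I A) (S x) \<partial>leb I)"
      using PA by (subst nn_integral_distr) (auto simp: nn_integral_density)
    also have "\<dots> = (\<integral>\<^sup>+x. (\<Prod>i\<in>I. w i (x i) * indicator (A i) (T i (x i))) \<partial>leb I)"
    proof (rule nn_integral_cong)
      fix x
      have "indicator (Pi\<^sub>E I A) (S x) = (\<Prod>i\<in>I. indicator (A i) (T i (x i)) :: ennreal)"
      proof (cases "S x \<in> Pi\<^sub>E I A")
        case True
        then show ?thesis by (auto simp: S_def PiE_iff)
      next
        case False
        then obtain i where "i \<in> I" "T i (x i) \<notin> A i" by (auto simp: S_def PiE_iff)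
        then have "(\<Prod>i\<in>I. indicator (A i) (T i (x i)) :: ennreal) = 0"
          using \<open>i \<in> I\<close> by (intro prod_zero fin bexI[of _ i]) auto
        then show ?thesis using False by simp
      qed
      then show "W x * indicator (Pi\<^sub>E I A) (S x) = (\<Prod>i\<in>I. w i (x i) * indicator (A i) (T i (x i)))"
        by (simp add: W_def prod.distrib)
    qed
    also have "\<dots> = (\<Prod>i\<in>I. \<integral>\<^sup>+t. w i t * indicator (A i) (T i t) \<partial>lborel)"
      by (rule leb.product_nn_integral_prod[OF fin]) simp
    also have "\<dots> = (\<Prod>i\<in>I. emeasure lborel (A i))"
    proof (rule prod.cong[OF refl])
      fix i assume i: "i \<in> I"
      have "emeasure lborel (A i) = (\<integral>\<^sup>+x. indicator (A i) x \<partial>(distr (density lborel (w i)) borel (T i)))"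
        using A'[OF i] by (simp add: sub[OF i])
      also have "\<dots> = (\<integral>\<^sup>+t. w i t * indicator (A i) (T i t) \<partial>lborel)"
        using A'[OF i] T[OF i] w[OF i] by (subst nn_integral_distr) (auto simp: nn_integral_density)
      finally show "(\<integral>\<^sup>+t. w i t * indicator (A i) (T i t) \<partial>lborel) = emeasure lborel (A i)" ..
    qed
    finally show "emeasure (distr (density (leb I) W) (leb I) S) (Pi\<^sub>E I A) = (\<Prod>i\<in>I. emeasure lborel (A i))" .
  qed simp
  have "(\<integral>\<^sup>+x. g x \<partial>leb I) = (\<integral>\<^sup>+x. g x \<partial>(distr (density (leb I) W) (leb I) S))"
    by (simp add: eq)
  also have "\<dots> = (\<integral>\<^sup>+x. W x * g (S x) \<partial>leb I)"
    by (subst nn_integral_distr) (auto simp: nn_integral_density)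
  finally show ?thesis by (simp add: W_def S_def)
qed

lemma nn_integral_leb_translate:
  assumes fin: "finite I" and g: "g \<in> borel_measurable (leb I)"
  shows "(\<integral>\<^sup>+x. g (\<lambda>i\<in>I. x i + b i) \<partial>leb I) = (\<integral>\<^sup>+x. g x \<partial>leb I)"
proof -
  have "distr (density lborel (\<lambda>_. 1)) borel (\<lambda>t. t + b i) = lborel" for i
    using lborel_distr_plus[of "b i"] by (simp add: density_1 add.commute[of _ "b i"])
  from nn_integral_leb_substitution[OF fin _ _ this g] show ?thesis by simp
qed

text \<open>Renumbers the coordinates \<open>n..<m\<close> from 0, because the matrix results below
  act on \<open>{..<k}\<close>.\<close>

lemma nn_integral_leb_shift:
  assumes g[measurable]: "g \<in> borel_measurable (leb {n..<m})"
  shows "(\<integral>\<^sup>+y. g y \<partial>leb {n..<m}) = (\<integral>\<^sup>+x. g (\<lambda>i\<in>{n..<m}. x (i - n)) \<partial>leb {..<m - n})"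
proof -
  define S where "S = (\<lambda>x::nat \<Rightarrow> real. \<lambda>i\<in>{n..<m}. x (i - n))"
  have S[measurable]: "S \<in> leb {..<m - n} \<rightarrow>\<^sub>M leb {n..<m}"
    unfolding S_def by (intro measurable_restrict measurable_component_singleton) auto
  have "distr (leb {..<m - n}) (leb {n..<m}) S = leb {n..<m}"
  proof (rule leb.PiM_eqI)
    fix A :: "nat \<Rightarrow> real set" assume A: "\<And>i. i \<in> {n..<m} \<Longrightarrow> A i \<in> sets lborel"
    have "S -` Pi\<^sub>E {n..<m} A \<inter> space (leb {..<m-n}) = Pi\<^sub>E {..<m-n} (\<lambda>j. A (j + n))"
    proof (intro equalityI subsetI)
      fix x assume x: "x \<in> S -` Pi\<^sub>E {n..<m} A \<inter> space (leb {..<m-n})"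
      have "x j \<in> A (j + n)" if "j < m - n" for j
      proof -
        have "S x (j + n) \<in> A (j + n)" using x that by (auto simp: PiE_iff)
        moreover have "S x (j + n) = x j" using that by (simp add: S_def less_diff_conv)
        ultimately show ?thesis by simp
      qed
      then show "x \<in> Pi\<^sub>E {..<m-n} (\<lambda>j. A (j + n))"
        using x by (auto simp: space_PiM PiE_iff)
    next
      fix x assume x: "x \<in> Pi\<^sub>E {..<m-n} (\<lambda>j. A (j + n))"
      have "x (i - n) \<in> A i" if "i \<in> {n..<m}" for i
        using x that by (auto simp: PiE_iff dest!: bspec[where x="i - n"])
      then show "x \<in> S -` Pi\<^sub>E {n..<m} A \<inter> space (leb {..<m-n})"
        using x by (auto simp: space_PiM PiE_iff S_def)
    qed
    then have "emeasure (distr (leb {..<m - n}) (leb {n..<m}) S) (Pi\<^sub>E {n..<m} A)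
      = emeasure (leb {..<m-n}) (Pi\<^sub>E {..<m-n} (\<lambda>j. A (j + n)))"
      using A by (subst emeasure_distr) (auto intro!: sets_PiM_I_finite)
    also have "\<dots> = (\<Prod>j<m-n. emeasure lborel (A (j + n)))"
      using A by (subst leb.emeasure_PiM) auto
    also have "\<dots> = (\<Prod>i\<in>{n..<m}. emeasure lborel (A i))"
      by (rule prod.reindex_bij_witness[of _ "\<lambda>i. i - n" "\<lambda>j. j + n"]) auto
    finally show "emeasure (distr (leb {..<m - n}) (leb {n..<m}) S) (Pi\<^sub>E {n..<m} A) =
      (\<Prod>i\<in>{n..<m}. emeasure lborel (A i))" .
  qed simp_all
  then have "(\<integral>\<^sup>+y. g y \<partial>leb {n..<m}) = (\<integral>\<^sup>+y. g y \<partial>distr (leb {..<m - n}) (leb {n..<m}) S)"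
    by simp
  also have "\<dots> = (\<integral>\<^sup>+x. g (S x) \<partial>leb {..<m - n})"
    by (rule nn_integral_distr) auto
  finally show ?thesis by (simp add: S_def)
qed

section \<open>Lebesgue measure under invertible matrices\<close>

definition mat_app :: "real Matrix.mat \<Rightarrow> (nat \<Rightarrow> real) \<Rightarrow> nat \<Rightarrow> real" where
  "mat_app A x = (\<lambda>i\<in>{..<dim_row A}. \<Sum>j<dim_col A. A $$ (i, j) * x j)"

lemma measurable_mat_app [measurable]:
  assumes "A \<in> carrier_mat k l"
  shows "mat_app A \<in> leb {..<l} \<rightarrow>\<^sub>M leb {..<k}"
proof -
  have "(\<lambda>x. \<lambda>i\<in>{..<k}. \<Sum>j<l. A $$ (i, j) * x j) \<in> leb {..<l} \<rightarrow>\<^sub>M leb {..<k}"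
    by measurable
  then show ?thesis using assms by (simp add: mat_app_def[abs_def])
qed

lemma mat_app_mult:
  assumes A: "A \<in> carrier_mat k l" and B: "B \<in> carrier_mat l q"
  shows "mat_app (A * B) x = mat_app A (mat_app B x)"
proof
  fix i
  show "mat_app (A * B) x i = mat_app A (mat_app B x) i"
  proof (cases "i < k")
    case True
    have "(\<Sum>j<q. (A * B) $$ (i, j) * x j) = (\<Sum>j<q. \<Sum>a<l. A $$ (i, a) * B $$ (a, j) * x j)"
      using True A B
      by (intro sum.cong refl)
        (auto simp: times_mat_def scalar_prod_def sum_distrib_right atLeast0LessThan)
    also have "\<dots> = (\<Sum>a<l. A $$ (i, a) * (\<Sum>j<q. B $$ (a, j) * x j))"
      by (subst sum.swap) (simp add: sum_distrib_left mult.assoc)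
    finally show ?thesis using True A B by (simp add: mat_app_def)
  next
    case False
    then show ?thesis using A B by (simp add: mat_app_def)
  qed
qed

text \<open>\<open>mat_app\<close> is \<open>undefined\<close> off the index range, so the identity
  matrix fixes only the extensional functions, that is, the points of the product space.\<close>

lemma mat_app_one:
  assumes "x \<in> space (leb {..<k})"
  shows "mat_app (1\<^sub>m k) x = x"
proof
  fix i
  have "(\<Sum>j<k. (1\<^sub>m k) $$ (i, j) * x j) = (\<Sum>j<k. if i = j then x j else 0)" if "i < k"
    using that by (intro sum.cong) auto
  then show "mat_app (1\<^sub>m k) x i = x i"
    using assms by (auto simp: mat_app_def space_PiM PiE_def extensional_def)
qed

text \<open>The determinant multiplies the integral of the pulled-back function. In this form the
  property passes to products by multiplicativity of the determinant, and no inverse matrix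
  appears.\<close>

definition scales_leb :: "nat \<Rightarrow> real Matrix.mat \<Rightarrow> bool" where
  "scales_leb k A \<longleftrightarrow> (\<forall>g \<in> borel_measurable (leb {..<k}).
     ennreal \<bar>Determinant.det A\<bar> * (\<integral>\<^sup>+x. g (mat_app A x) \<partial>leb {..<k}) = (\<integral>\<^sup>+x. g x \<partial>leb {..<k}))"

lemma scales_leb_mult:
  assumes A: "A \<in> carrier_mat k k" and B: "B \<in> carrier_mat k k"
    and sA: "scales_leb k A" and sB: "scales_leb k B"
  shows "scales_leb k (A * B)"
  unfolding scales_leb_def
proof
  fix g :: "(nat \<Rightarrow> real) \<Rightarrow> ennreal" assume g[measurable]: "g \<in> borel_measurable (leb {..<k})"
  note measurable_mat_app[OF A, measurable]
  have gA: "(\<lambda>x. g (mat_app A x)) \<in> borel_measurable (leb {..<k})" by measurable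
  have "ennreal \<bar>Determinant.det (A * B)\<bar> * (\<integral>\<^sup>+x. g (mat_app (A * B) x) \<partial>leb {..<k})
    = ennreal \<bar>Determinant.det A\<bar> * (ennreal \<bar>Determinant.det B\<bar> * (\<integral>\<^sup>+x. g (mat_app A (mat_app B x)) \<partial>leb {..<k}))"
    by (simp add: Determinant.det_mult[OF A B] mat_app_mult[OF A B] abs_mult ennreal_mult mult.assoc)
  also have "\<dots> = (\<integral>\<^sup>+x. g x \<partial>leb {..<k})"
    using sA sB[unfolded scales_leb_def, rule_format, OF gA] g by (simp add: scales_leb_def)
  finally show "ennreal \<bar>Determinant.det (A * B)\<bar> * (\<integral>\<^sup>+x. g (mat_app (A * B) x) \<partial>leb {..<k}) =
    (\<integral>\<^sup>+x. g x \<partial>leb {..<k})" .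
qed

text \<open>Blocks with a last block of size one: this shear adds a linear combination of the first
  \<open>k\<close> coordinates to the last one, while \<open>up_shear\<close> adds multiples of the
  last coordinate to the first \<open>k\<close>.\<close>

definition low_shear :: "nat \<Rightarrow> real Matrix.mat \<Rightarrow> real Matrix.mat" where
  "low_shear k c = four_block_mat (1\<^sub>m k) (0\<^sub>m k 1) c (1\<^sub>m 1)"

definition up_shear :: "nat \<Rightarrow> real Matrix.mat \<Rightarrow> real Matrix.mat" where
  "up_shear k b = four_block_mat (1\<^sub>m k) b (0\<^sub>m 1 k) (1\<^sub>m 1)"

lemma sum_delta_row:
  fixes x :: "nat \<Rightarrow> real"
  shows "i < k \<Longrightarrow> (\<Sum>j<k. (if i = j then 1 else 0) * x j) = x i"
proof -
  assume "i < k"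
  have "(\<Sum>j<k. (if i = j then 1 else 0) * x j) = (\<Sum>j<k. if i = j then x j else 0)"
    by (intro sum.cong) auto
  also have "\<dots> = x i" using \<open>i < k\<close> by (simp add: sum.delta')
  finally show ?thesis .
qed

lemma det_low_shear: "c \<in> carrier_mat 1 k \<Longrightarrow> Determinant.det (low_shear k c) = 1"
  unfolding low_shear_def by (subst det_four_block_mat_upper_right_zero) auto

lemma det_up_shear: "b \<in> carrier_mat k 1 \<Longrightarrow> Determinant.det (up_shear k b) = 1"
  unfolding up_shear_def by (subst det_four_block_mat_lower_left_zero) auto

text \<open>With the first \<open>k\<close> coordinates frozen the shear translates the last
  coordinate, which is therefore integrated innermost.\<close>

lemma scales_leb_low_shear:
  assumes c: "c \<in> carrier_mat 1 k"
  shows "scales_leb (Suc k) (low_shear k c)"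
  unfolding scales_leb_def
proof
  fix g :: "(nat \<Rightarrow> real) \<Rightarrow> ennreal" assume g[measurable]: "g \<in> borel_measurable (leb {..<Suc k})"
  have g'[measurable]: "g \<in> borel_measurable (leb (insert k {..<k}))" using g by (simp add: lessThan_Suc)
  let ?A = "low_shear k c"
  have A: "?A \<in> carrier_mat (Suc k) (Suc k)"
    using c unfolding low_shear_def by auto
  note measurable_mat_app[OF A, measurable]
  have det: "Determinant.det ?A = 1"
    by (rule det_low_shear) (rule c)
  \<comment> \<open>The factor \<open>1 *\<close> is kept so that the new last coordinate has the
    form \<open>t + c * y\<close> of \<open>nn_integral_real_affine\<close> with
    \<open>c = 1\<close>.\<close>
  have app: "mat_app ?A (x(k := y)) = x(k := (\<Sum>j<k. c $$ (0, j) * x j) + 1 * y)"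
    if x: "x \<in> space (leb {..<k})" for x y
  proof
    fix i
    consider "i < k" | "i = k" | "i > k" by linarith
    then show "mat_app ?A (x(k := y)) i = (x(k := (\<Sum>j<k. c $$ (0, j) * x j) + 1 * y)) i"
    proof cases
      case 1
      then have "(\<Sum>j<k. ?A $$ (i, j) * (x(k := y)) j) = (\<Sum>j<k. (if i = j then 1 else 0) * x j)"
        using c by (intro sum.cong) (auto simp: low_shear_def)
      with 1 show ?thesis using A c
        by (simp add: mat_app_def sum_delta_row) (simp add: low_shear_def)
    next
      case 2
      then show ?thesis using A c
        by (simp add: mat_app_def low_shear_def)
    next
      case 3
      then show ?thesis using A c x
        by (auto simp: mat_app_def space_PiM PiE_def extensional_def)
    qed
  qed
  have "(\<integral>\<^sup>+x. g (mat_app ?A x) \<partial>leb {..<Suc k})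
    = (\<integral>\<^sup>+x. \<integral>\<^sup>+y. g (mat_app ?A (x(k := y))) \<partial>lborel \<partial>leb {..<k})"
    unfolding lessThan_Suc
    by (rule leb.product_nn_integral_insert) (auto simp flip: lessThan_Suc)
  also have "\<dots> = (\<integral>\<^sup>+x. \<integral>\<^sup>+y. g (x(k := y)) \<partial>lborel \<partial>leb {..<k})"
  proof (rule nn_integral_cong)
    fix x assume x: "x \<in> space (leb {..<k})"
    have [measurable]: "(\<lambda>y. g (x(k := y))) \<in> borel_measurable borel"
      using measurable_comp[OF measurable_component_update[OF x, of k] g'] by (simp add: comp_def)
    show "(\<integral>\<^sup>+y. g (mat_app ?A (x(k := y))) \<partial>lborel) = (\<integral>\<^sup>+y. g (x(k := y)) \<partial>lborel)"
      unfolding app[OF x]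
      by (subst (2) nn_integral_real_affine[where c=1 and t="\<Sum>j<k. c $$ (0, j) * x j"]) auto
  qed
  also have "\<dots> = (\<integral>\<^sup>+x. g x \<partial>leb {..<Suc k})"
    unfolding lessThan_Suc
    by (rule leb.product_nn_integral_insert[symmetric]) auto
  finally show "ennreal \<bar>Determinant.det ?A\<bar> * (\<integral>\<^sup>+x. g (mat_app ?A x) \<partial>leb {..<Suc k}) =
    (\<integral>\<^sup>+x. g x \<partial>leb {..<Suc k})" by (simp add: det)
qed

lemma measurable_upd_leb:
  assumes g: "g \<in> borel_measurable (leb {..<Suc k})"
  shows "(\<lambda>x. g (x(k := y))) \<in> borel_measurable (leb {..<k})"
proof -
  have "(\<lambda>x. x(k := y)) \<in> leb {..<k} \<rightarrow>\<^sub>M leb (insert k {..<k})"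
    by measurable
  from measurable_compose[OF this] g show ?thesis by (simp add: lessThan_Suc)
qed

text \<open>The roles are exchanged: with the last coordinate frozen the shear translates the first
  \<open>k\<close> coordinates, so these are integrated innermost.\<close>

lemma scales_leb_up_shear:
  assumes b: "b \<in> carrier_mat k 1"
  shows "scales_leb (Suc k) (up_shear k b)"
  unfolding scales_leb_def
proof
  fix g :: "(nat \<Rightarrow> real) \<Rightarrow> ennreal" assume g[measurable]: "g \<in> borel_measurable (leb {..<Suc k})"
  let ?A = "up_shear k b"
  have A: "?A \<in> carrier_mat (Suc k) (Suc k)"
    using b unfolding up_shear_def by auto
  note measurable_mat_app[OF A, measurable]
  have det: "Determinant.det ?A = 1"
    by (rule det_up_shear) (rule b)
  have app: "mat_app ?A (x(k := y)) = (\<lambda>i\<in>{..<k}. x i + b $$ (i, 0) * y)(k := y)" for x y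
  proof
    fix i
    consider "i < k" | "i = k" | "i > k" by linarith
    then show "mat_app ?A (x(k := y)) i = ((\<lambda>i\<in>{..<k}. x i + b $$ (i, 0) * y)(k := y)) i"
    proof cases
      case 1
      then have "(\<Sum>j<k. ?A $$ (i, j) * (x(k := y)) j) = (\<Sum>j<k. (if i = j then 1 else 0) * x j)"
        using b by (intro sum.cong) (auto simp: up_shear_def)
      with 1 show ?thesis using A b
        by (simp add: mat_app_def sum_delta_row) (simp add: up_shear_def)
    next
      case 2
      then show ?thesis using A b
        by (simp add: mat_app_def up_shear_def)
    next
      case 3
      then show ?thesis using A b
        by (auto simp: mat_app_def)
    qed
  qed
  have "(\<integral>\<^sup>+x. g (mat_app ?A x) \<partial>leb {..<Suc k})
    = (\<integral>\<^sup>+y. \<integral>\<^sup>+x. g (mat_app ?A (x(k := y))) \<partial>leb {..<k} \<partial>lborel)"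
    unfolding lessThan_Suc
    by (rule leb.product_nn_integral_insert_rev) (auto simp flip: lessThan_Suc)
  also have "\<dots> = (\<integral>\<^sup>+y. \<integral>\<^sup>+x. g (x(k := y)) \<partial>leb {..<k} \<partial>lborel)"
    unfolding app
    by (rule nn_integral_cong, rule nn_integral_leb_translate)
      (auto intro: measurable_upd_leb)
  also have "\<dots> = (\<integral>\<^sup>+x. g x \<partial>leb {..<Suc k})"
    unfolding lessThan_Suc
    by (rule leb.product_nn_integral_insert_rev[symmetric]) (auto simp flip: lessThan_Suc)
  finally show "ennreal \<bar>Determinant.det ?A\<bar> * (\<integral>\<^sup>+x. g (mat_app ?A x) \<partial>leb {..<Suc k}) =
    (\<integral>\<^sup>+x. g x \<partial>leb {..<Suc k})" by (simp add: det)
qed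

text \<open>Integrate with the last coordinate outermost: scaling the line contributes the absolute
  value of \<open>d\<close>, and the hypothesis on \<open>B\<close>, applied for each fixed last
  coordinate, contributes that of its determinant.\<close>

lemma scales_leb_block:
  assumes B: "B \<in> carrier_mat k k" and sB: "scales_leb k B" and d: "d \<noteq> 0"
  shows "scales_leb (Suc k) (four_block_mat B (0\<^sub>m k 1) (0\<^sub>m 1 k) (d \<cdot>\<^sub>m 1\<^sub>m 1))"
  unfolding scales_leb_def
proof
  fix g :: "(nat \<Rightarrow> real) \<Rightarrow> ennreal" assume g[measurable]: "g \<in> borel_measurable (leb {..<Suc k})"
  have g'[measurable]: "g \<in> borel_measurable (leb (insert k {..<k}))" using g by (simp add: lessThan_Suc)
  let ?A = "four_block_mat B (0\<^sub>m k 1) (0\<^sub>m 1 k) (d \<cdot>\<^sub>m 1\<^sub>m 1)"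
  have A: "?A \<in> carrier_mat (Suc k) (Suc k)"
    using B by auto
  note measurable_mat_app[OF A, measurable]
  note measurable_mat_app[OF B, measurable]
  have det: "Determinant.det ?A = Determinant.det B * d"
    using B by (subst det_four_block_mat_lower_left_zero) auto
  have app: "mat_app ?A (x(k := y)) = (mat_app B x)(k := 0 + d * y)" for x y
  proof
    fix i
    consider "i < k" | "i = k" | "i > k" by linarith
    then show "mat_app ?A (x(k := y)) i = ((mat_app B x)(k := 0 + d * y)) i"
    proof cases
      case 1
      then have "(\<Sum>j<k. ?A $$ (i, j) * (x(k := y)) j) = (\<Sum>j<k. B $$ (i, j) * x j)"
        using B by (intro sum.cong) auto
      with 1 show ?thesis using A B
        by (simp add: mat_app_def)
    next
      case 2
      then show ?thesis using A B
        by (simp add: mat_app_def)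
    next
      case 3
      then show ?thesis using A B
        by (auto simp: mat_app_def)
    qed
  qed
  have inner: "ennreal \<bar>Determinant.det B\<bar> * (\<integral>\<^sup>+x. g ((mat_app B x)(k := y)) \<partial>leb {..<k})
      = (\<integral>\<^sup>+x. g (x(k := y)) \<partial>leb {..<k})" for y
    using sB[unfolded scales_leb_def, rule_format, OF measurable_upd_leb[OF g]] .
  interpret sigma_finite_measure "leb {..<k}" by (rule leb.sigma_finite) simp
  have "(\<lambda>p. (mat_app B (snd p), fst p)) \<in> borel \<Otimes>\<^sub>M leb {..<k} \<rightarrow>\<^sub>M leb {..<k} \<Otimes>\<^sub>M lborel"
    by measurable
  from measurable_compose[OF measurable_compose[OF this measurable_add_dim] g']
  have [measurable]: "(\<lambda>p. g ((mat_app B (snd p))(k := fst p))) \<in> borel_measurable (borel \<Otimes>\<^sub>M leb {..<k})"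
    by simp
  have m2: "(\<lambda>y. \<integral>\<^sup>+x. g ((mat_app B x)(k := y)) \<partial>leb {..<k}) \<in> borel_measurable borel"
    by (rule borel_measurable_nn_integral) (simp add: split_beta')
  have "(\<integral>\<^sup>+x. g (mat_app ?A x) \<partial>leb {..<Suc k})
    = (\<integral>\<^sup>+y. \<integral>\<^sup>+x. g ((mat_app B x)(k := 0 + d * y)) \<partial>leb {..<k} \<partial>lborel)"
    unfolding lessThan_Suc app[symmetric]
    by (rule leb.product_nn_integral_insert_rev)
      (use measurable_compose[OF measurable_mat_app[OF A] g] in \<open>auto simp flip: lessThan_Suc\<close>)
  then have "ennreal \<bar>Determinant.det ?A\<bar> * (\<integral>\<^sup>+x. g (mat_app ?A x) \<partial>leb {..<Suc k})
    = ennreal \<bar>Determinant.det B\<bar> * (\<bar>d\<bar> * (\<integral>\<^sup>+y. \<integral>\<^sup>+x. g ((mat_app B x)(k := 0 + d * y)) \<partial>leb {..<k} \<partial>lborel))"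
    by (simp only: det abs_mult ennreal_mult abs_ge_zero mult.assoc)
  also have "\<bar>d\<bar> * (\<integral>\<^sup>+y. \<integral>\<^sup>+x. g ((mat_app B x)(k := 0 + d * y)) \<partial>leb {..<k} \<partial>lborel)
    = (\<integral>\<^sup>+y. \<integral>\<^sup>+x. g ((mat_app B x)(k := y)) \<partial>leb {..<k} \<partial>lborel)"
    by (rule nn_integral_real_affine[OF m2 d, symmetric])
  also have "ennreal \<bar>Determinant.det B\<bar> * \<dots> = (\<integral>\<^sup>+y. \<integral>\<^sup>+x. g (x(k := y)) \<partial>leb {..<k} \<partial>lborel)"
    unfolding inner[symmetric] using m2 by (subst nn_integral_cmult) auto
  also have "\<dots> = (\<integral>\<^sup>+x. g x \<partial>leb {..<Suc k})"
    unfolding lessThan_Suc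
    by (rule leb.product_nn_integral_insert_rev[symmetric]) (auto simp flip: lessThan_Suc)
  finally show "ennreal \<bar>Determinant.det ?A\<bar> * (\<integral>\<^sup>+x. g (mat_app ?A x) \<partial>leb {..<Suc k}) =
    (\<integral>\<^sup>+x. g x \<partial>leb {..<Suc k})" .
qed

text \<open>The Schur complement of the entry \<open>A\<^sub>k\<^sub>k\<close> factors \<open>A\<close> into two shears and a block diagonal matrix.\<close>

lemma scales_leb_pivot:
  assumes A: "A \<in> carrier_mat (Suc k) (Suc k)" and d: "A $$ (k, k) \<noteq> 0"
    and det: "Determinant.det A \<noteq> 0"
    and IH: "\<And>B. B \<in> carrier_mat k k \<Longrightarrow> Determinant.det B \<noteq> 0 \<Longrightarrow> scales_leb k B"
  shows "scales_leb (Suc k) A"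
proof -
  define d where "d = A $$ (k, k)"
  define B where "B = Matrix.mat k k (\<lambda>(i, j). A $$ (i, j) - A $$ (i, k) * A $$ (k, j) / d)"
  define b where "b = Matrix.mat k 1 (\<lambda>(i, j). A $$ (i, k) / d)"
  define c where "c = Matrix.mat 1 k (\<lambda>(i, j). A $$ (k, j) / d)"
  define G where "G = four_block_mat B (0\<^sub>m k 1) (0\<^sub>m 1 k) (d \<cdot>\<^sub>m 1\<^sub>m 1)"
  have d0: "d \<noteq> 0" using assms by (simp add: d_def)
  have cB: "B \<in> carrier_mat k k" and cb: "b \<in> carrier_mat k 1" and cc: "c \<in> carrier_mat 1 k"
    by (auto simp: B_def b_def c_def)
  have cG: "G \<in> carrier_mat (Suc k) (Suc k)" using cB by (auto simp: G_def)
  have cL: "low_shear k c \<in> carrier_mat (Suc k) (Suc k)" using cc by (auto simp: low_shear_def)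
  have cU: "up_shear k b \<in> carrier_mat (Suc k) (Suc k)" using cb by (auto simp: up_shear_def)
  have GL: "G * low_shear k c = four_block_mat B (0\<^sub>m k 1) (d \<cdot>\<^sub>m c) (d \<cdot>\<^sub>m 1\<^sub>m 1)"
    unfolding G_def low_shear_def using cB cc
    by (subst mult_four_block_mat[of _ k k _ 1 _ 1 _ _ k _ 1]) auto
  have UGL: "up_shear k b * (G * low_shear k c)
      = four_block_mat (B + b * (d \<cdot>\<^sub>m c)) (d \<cdot>\<^sub>m b) (d \<cdot>\<^sub>m c) (d \<cdot>\<^sub>m 1\<^sub>m 1)"
    unfolding GL up_shear_def using cB cc cb
    by (subst mult_four_block_mat[of _ k k _ 1 _ 1 _ _ k _ 1])
      (auto simp: mult_smult_distrib)
  have eq: "A = up_shear k b * (G * low_shear k c)"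
    unfolding UGL
  proof (rule eq_matI)
    fix i j
    assume "i < dim_row (four_block_mat (B + b * (d \<cdot>\<^sub>m c)) (d \<cdot>\<^sub>m b) (d \<cdot>\<^sub>m c) (d \<cdot>\<^sub>m 1\<^sub>m 1))"
      "j < dim_col (four_block_mat (B + b * (d \<cdot>\<^sub>m c)) (d \<cdot>\<^sub>m b) (d \<cdot>\<^sub>m c) (d \<cdot>\<^sub>m 1\<^sub>m 1))"
    then have ij: "i < Suc k" "j < Suc k" using cB cb cc by auto
    have 1: "(b * (d \<cdot>\<^sub>m c)) $$ (i, j) = A $$ (i, k) * A $$ (k, j) / d" if "i < k" "j < k"
      using that cb cc d0 by (simp add: scalar_prod_def b_def c_def)
    show "A $$ (i, j) = four_block_mat (B + b * (d \<cdot>\<^sub>m c)) (d \<cdot>\<^sub>m b) (d \<cdot>\<^sub>m c) (d \<cdot>\<^sub>m 1\<^sub>m 1) $$ (i, j)"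
    proof (cases "i < k")
      case True
      then show ?thesis
      proof (cases "j < k")
        case True
        then show ?thesis using \<open>i < k\<close> 1 cB cb cc by (simp add: B_def)
      next
        case False
        then have "j = k" using ij by simp
        then show ?thesis using \<open>i < k\<close> cB cb cc d0 by (simp add: b_def)
      qed
    next
      case False
      then have ik: "i = k" using ij by simp
      show ?thesis
      proof (cases "j < k")
        case True
        then show ?thesis using ik cB cb cc d0 by (simp add: c_def)
      next
        case False
        then have "j = k" using ij by simp
        then show ?thesis using ik cB cb cc by (simp add: d_def)
      qed
    qed
  qed (use A cB cb cc in auto)
  \<comment> \<open>The shears have determinant one, so invertibility of \<open>A\<close> passes to
    the smaller block \<open>B\<close>, to which \<open>IH\<close> applies.\<close>
  have "Determinant.det A = Determinant.det G"
    unfolding eq Determinant.det_mult[OF cU mult_carrier_mat[OF cG cL]] Determinant.det_mult[OF cG cL]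
    by (simp add: det_low_shear[OF cc] det_up_shear[OF cb])
  also have "\<dots> = Determinant.det B * d"
    unfolding G_def using cB by (subst det_four_block_mat_lower_left_zero) auto
  finally have "Determinant.det B \<noteq> 0" using det by auto
  then have "scales_leb (Suc k) G"
    unfolding G_def by (intro scales_leb_block cB IH d0)
  then show ?thesis
    unfolding eq using cG cL cU
    by (intro scales_leb_mult scales_leb_up_shear[OF cb] scales_leb_low_shear[OF cc]) auto
qed

text \<open>Gaussian elimination as an induction on the dimension, with the last diagonal entry as
  pivot.\<close>

lemma scales_leb_invertible:
  assumes "A \<in> carrier_mat k k" "Determinant.det A \<noteq> 0"
  shows "scales_leb k A"
  using assms
proof (induction k arbitrary: A)
  case 0
  have "mat_app A x = x" if "x \<in> space (leb {..<0})" for x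
    using that 0 by (auto simp: mat_app_def space_PiM)
  then have "(\<integral>\<^sup>+x. g (mat_app A x) \<partial>leb {..<0}) = (\<integral>\<^sup>+x. g x \<partial>leb {..<0})" for g
    by (intro nn_integral_cong) simp
  moreover have "Determinant.det A = 1" using 0 by (simp add: det_dim_zero)
  ultimately show ?case unfolding scales_leb_def by simp
next
  case (Suc k)
  note A = Suc.prems(1)
  obtain B where B: "B \<in> carrier_mat (Suc k) (Suc k)" "B * A = 1\<^sub>m (Suc k)"
    using det_non_zero_imp_unit[OF Suc.prems, of "()"]
    by (auto simp: Units_def ring_mat_def)
  \<comment> \<open>If the last column of \<open>A\<close> vanished, so would the entry of
    \<open>B * A\<close> at \<open>(k, k)\<close>, which is 1.\<close>
  have "(\<Sum>i<Suc k. B $$ (k, i) * A $$ (i, k)) = (B * A) $$ (k, k)"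
    using A B(1) by (simp add: scalar_prod_def atLeast0LessThan)
  also have "\<dots> = 1" using B(2) by simp
  finally obtain i where i: "i < Suc k" "A $$ (i, k) \<noteq> 0"
    by (metis (no_types, lifting) lessThan_iff mult_zero_right sum.neutral zero_neq_one)
  show ?case
  proof (cases "A $$ (k, k) = 0")
    case False
    then show ?thesis using scales_leb_pivot[OF A False Suc.prems(2) Suc.IH] by blast
  next
    case True
    with i have ik: "i < k" by (metis less_SucE)
    \<comment> \<open>Adding row \<open>i\<close> to the last row makes the pivot nonzero.\<close>
    define c where "c = (\<lambda>s::real. Matrix.mat 1 k (\<lambda>(a, j). if j = i then s else 0))"
    have cc: "c s \<in> carrier_mat 1 k" for s by (simp add: c_def)
    have cL: "low_shear k (c s) \<in> carrier_mat (Suc k) (Suc k)" for s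
      using cc by (auto simp: low_shear_def)
    have det: "Determinant.det (low_shear k (c s)) = 1" for s
      by (rule det_low_shear) (rule cc)
    have "low_shear k (c (-1)) * low_shear k (c 1) = four_block_mat (1\<^sub>m k) (0\<^sub>m k 1) (c (-1) + c 1) (1\<^sub>m 1)"
      unfolding low_shear_def using cc[of 1] cc[of "-1"]
      by (subst mult_four_block_mat[of _ k k _ 1 _ 1 _ _ k _ 1]) auto
    also have "c (-1) + c 1 = 0\<^sub>m 1 k" by (rule eq_matI) (auto simp: c_def)
    also have "four_block_mat (1\<^sub>m k) (0\<^sub>m k 1) (0\<^sub>m 1 k) (1\<^sub>m 1) = (1\<^sub>m (Suc k) :: real Matrix.mat)"
      by (rule eq_matI) auto
    finally have inv: "low_shear k (c (-1)) * low_shear k (c 1) = 1\<^sub>m (Suc k)" .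
    let ?A = "low_shear k (c 1) * A"
    have cA: "?A \<in> carrier_mat (Suc k) (Suc k)" using mult_carrier_mat[OF cL A] .
    have "?A $$ (k, k) = (\<Sum>j<Suc k. low_shear k (c 1) $$ (k, j) * A $$ (j, k))"
      using A cL[of 1] by (simp add: scalar_prod_def atLeast0LessThan)
    also have "\<dots> = (\<Sum>j<k. (if i = j then 1 else 0) * A $$ (j, k)) + A $$ (k, k)"
      unfolding sum.lessThan_Suc
      by (intro arg_cong2[where f="(+)"] sum.cong refl) (auto simp: low_shear_def c_def)
    also have "\<dots> = A $$ (i, k)" using ik True by (simp only: sum_delta_row add_0_right)
    finally have "?A $$ (k, k) \<noteq> 0" using i by simp
    moreover have "Determinant.det ?A \<noteq> 0"
      using Determinant.det_mult[OF cL A] det Suc.prems(2) by simp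
    ultimately have "scales_leb (Suc k) ?A"
      using scales_leb_pivot[OF cA _ _ Suc.IH] by blast
    \<comment> \<open>The opposite shear undoes the row addition.\<close>
    then have "scales_leb (Suc k) (low_shear k (c (-1)) * ?A)"
      by (intro scales_leb_mult[OF cL cA] scales_leb_low_shear[OF cc]) auto
    also have "low_shear k (c (-1)) * ?A = A"
      using assoc_mult_mat[OF cL cL A, of "-1" 1] inv A by simp
    finally show ?thesis .
  qed
qed

section \<open>Monotone transport on the line\<close>

text \<open>\<open>G\<close> is the distribution function of \<open>f\<close>. Strict monotonicity
  leaves the limits 0 and the total mass unattained, and continuity fills in everything between. The
  exact range matters later, when one such function is composed with the inverse of another.\<close>

lemma antiderivative_of_density:
  fixes f :: "real \<Rightarrow> real"
  assumes cont: "continuous_on UNIV f" and pos: "\<And>t. 0 < f t" and int: "integrable lborel f"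
  shows "\<exists>G. (\<forall>t. (G has_real_derivative f t) (at t)) \<and> strict_mono G \<and>
    range G = {0<..<integral\<^sup>L lborel f}"
proof -
  define c where "c = integral\<^sup>L lborel f"
  define G where "G = (\<lambda>t. \<integral>x. indicator {..t} x *\<^sub>R f x \<partial>lborel)"
  have lim_top: "(G \<longlongrightarrow> c) at_top"
    unfolding G_def c_def by (rule tendsto_integral_at_top[OF _ int]) simp
  have "((\<lambda>t. \<integral>x. indicator {..-t} x *\<^sub>R f x \<partial>lborel) \<longlongrightarrow> (\<integral>x. 0 \<partial>(lborel :: real measure))) at_top"
  proof (rule integral_dominated_convergence_at_top[where w=f])
    show "\<forall>\<^sub>F i in at_top. AE x in lborel. norm (indicator {..- i} x *\<^sub>R f x) \<le> f x"
      by (intro always_eventually allI AE_I2) (simp add: less_imp_le[OF pos] split: split_indicator)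
    show "AE x in lborel. ((\<lambda>i. indicator {..- i} x *\<^sub>R f x) \<longlongrightarrow> 0) at_top"
    proof (rule AE_I2)
      fix x :: real
      have "\<forall>\<^sub>F i in at_top. indicator {..- i} x *\<^sub>R f x = 0"
        using eventually_gt_at_top[of "-x"] by eventually_elim (auto split: split_indicator)
      then show "((\<lambda>i. indicator {..- i} x *\<^sub>R f x) \<longlongrightarrow> 0) at_top"
        by (simp add: tendsto_eventually)
    qed
    show "(\<lambda>x. indicator {..- i} x *\<^sub>R f x) \<in> borel_measurable lborel" for i
      using borel_measurable_integrable[OF int] by measurable
  qed (simp_all add: int)
  then have "((\<lambda>t. G (- t)) \<longlongrightarrow> 0) at_top" by (simp add: G_def)
  then have lim_bot: "(G \<longlongrightarrow> 0) at_bot"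
    by (simp add: filterlim_at_bot_mirror)
  have deriv: "(G has_real_derivative f t) (at t)" for t
  proof -
    \<comment> \<open>Near \<open>t\<close> the improper integral is a constant plus an integral
      over a compact interval, to which the fundamental theorem of calculus applies. Starting at
      \<open>t - 1\<close> keeps \<open>t\<close> in the interior, so the derivative is
      two-sided.\<close>
    define C where "C = (\<integral>x. indicator {..<t-1} x *\<^sub>R f x \<partial>lborel)"
    have G_eq: "G s = C + integral {t-1..s} f" if "s \<in> {t-1<..<t+1}" for s
    proof -
      have si: "set_integrable lborel A f" if "A \<in> sets borel" for A
        unfolding set_integrable_def using integrable_mult_indicator[of A lborel f, OF _ int] that by simp
      have "G s = (\<integral>x. indicator {..<t-1} x *\<^sub>R f x + indicator {t-1..s} x *\<^sub>R f x \<partial>lborel)"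
        unfolding G_def using that by (intro Bochner_Integration.integral_cong) (auto split: split_indicator)
      also have "\<dots> = C + (LINT x:{t-1..s}|lborel. f x)"
        unfolding C_def set_lebesgue_integral_def
        using si[of "{..<t-1}"] si[of "{t-1..s}"]
        by (subst Bochner_Integration.integral_add) (auto simp: set_integrable_def)
      also have "(LINT x:{t-1..s}|lborel. f x) = integral {t-1..s} f"
        by (rule set_borel_integral_eq_integral) (simp add: si)
      finally show ?thesis .
    qed
    have "((\<lambda>s. integral {t-1..s} f) has_real_derivative f t) (at t within {t-1..t+1})"
      using integral_has_real_derivative[of "t - 1" "t + 1" f t] continuous_on_subset[OF cont, of "{t-1..t+1}"]
      by simp
    then have "((\<lambda>s. integral {t-1..s} f) has_real_derivative f t) (at t)"
      using at_within_interior[of t "{t - 1..t + 1}"] by (simp only: interior_atLeastAtMost_real greaterThanLessThan_iff) simp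
    from DERIV_add[OF DERIV_const[of C] this]
    have "((\<lambda>s. C + integral {t-1..s} f) has_real_derivative f t) (at t)" by simp
    then show ?thesis
      by (rule has_field_derivative_transform_within_open[of _ _ _ "{t-1<..<t+1}"]) (auto simp: G_eq)
  qed
  have mono: "strict_mono G"
  proof (rule strict_monoI)
    fix x y :: real assume "x < y"
    then show "G x < G y"
      by (rule DERIV_pos_imp_increasing) (use deriv pos in blast)
  qed
  have contG: "continuous_on UNIV G"
    using deriv by (intro continuous_at_imp_continuous_on ballI DERIV_isCont)
  have "0 < G t" "G t < c" for t
  proof -
    \<comment> \<open>The limits yield weak bounds only; passing through \<open>t - 1\<close> and
      \<open>t + 1\<close> makes them strict.\<close>
    have "0 \<le> G (t - 1)"
    proof (rule tendsto_upperbound[OF lim_bot])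
      show "\<forall>\<^sub>F s in at_bot. G s \<le> G (t - 1)"
        using eventually_le_at_bot[of "t-1"]
        by eventually_elim (simp add: strict_mono_less_eq[OF mono])
    qed simp
    also have "\<dots> < G t" using mono by (simp add: strict_mono_less)
    finally show "0 < G t" .
    have "G t < G (t + 1)" using mono by (simp add: strict_mono_less)
    also have "\<dots> \<le> c"
    proof (rule tendsto_lowerbound[OF lim_top])
      show "\<forall>\<^sub>F s in at_top. G (t + 1) \<le> G s"
        using eventually_ge_at_top[of "t+1"]
        by eventually_elim (simp add: strict_mono_less_eq[OF mono])
    qed simp
    finally show "G t < c" .
  qed
  moreover have "y \<in> range G" if "0 < y" "y < c" for y
  proof -
    obtain a where a: "G a < y"
      using order_tendstoD(2)[OF lim_bot \<open>0 < y\<close>] by (auto simp: eventually_at_bot_linorder)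
    obtain b where b: "y < G b"
      using order_tendstoD(1)[OF lim_top \<open>y < c\<close>] by (auto simp: eventually_at_top_linorder)
    have "a \<le> b" using less_trans[OF a b] mono by (simp add: strict_mono_less less_imp_le)
    then obtain x where "G x = y"
      using IVT'[of G a y b] a b continuous_on_subset[OF contG, of "{a..b}"] by auto
    then show ?thesis by blast
  qed
  ultimately have "range G = {0<..<integral\<^sup>L lborel f}" by (auto simp: c_def)
  then show ?thesis by (intro exI[of _ G] conjI allI deriv mono)
qed

text \<open>\<open>u\<close> is the distribution function of \<open>F\<close> followed by the
  inverse of that of \<open>f\<close>. Equal masses give both the same range, so the composition is
  defined on the whole line and onto. Its derivative comes from the inverse function rule, as
  \<open>f\<close> never vanishes.\<close>

lemma monotone_transport:
  fixes f F :: "real \<Rightarrow> real"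
  assumes f: "continuous_on UNIV f" "\<And>t. 0 < f t" "integrable lborel f"
    and F: "continuous_on UNIV F" "\<And>t. 0 < F t" "integrable lborel F"
    and same: "integral\<^sup>L lborel f = integral\<^sup>L lborel F"
  shows "\<exists>u. strict_mono u \<and> surj u \<and> (\<forall>t. (u has_real_derivative F t / f (u t)) (at t))"
proof -
  obtain H where H': "(\<forall>t. (H has_real_derivative f t) (at t)) \<and> strict_mono H \<and>
    range H = {0<..<integral\<^sup>L lborel f}"
    using antiderivative_of_density[OF f] ..
  note H = spec[OF conjunct1[OF H']] conjunct1[OF conjunct2[OF H']] conjunct2[OF conjunct2[OF H']]
  obtain G where G': "(\<forall>t. (G has_real_derivative F t) (at t)) \<and> strict_mono G \<and>
    range G = {0<..<integral\<^sup>L lborel f}"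
    using antiderivative_of_density[OF F] unfolding same[symmetric] ..
  note G = spec[OF conjunct1[OF G']] conjunct1[OF conjunct2[OF G']] conjunct2[OF conjunct2[OF G']]
  have inj: "inj H" using H(2) by (rule strict_mono_imp_inj_on)
  define R where "R = inv_into UNIV H"
  define u where "u = R \<circ> G"
  have RH: "R (H x) = x" for x using inj by (simp add: R_def)
  have HR: "H (R y) = y" if "0 < y" "y < integral\<^sup>L lborel f" for y
  proof -
    have "y \<in> range H" using that H(3) by simp
    then show ?thesis by (simp add: R_def f_inv_into_f)
  qed
  have Gr: "0 < G t" "G t < integral\<^sup>L lborel f" for t
    using rangeI[of G t] unfolding G(3) by simp_all
  have Hu: "H (u t) = G t" for t using HR Gr by (simp add: u_def)
  have "strict_mono u"
  proof (rule strict_monoI)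
    fix s t :: real assume "s < t"
    then have "H (u s) < H (u t)" unfolding Hu using strict_mono_less[OF G(2)] by simp
    then show "u s < u t" using strict_mono_less[OF H(2)] by simp
  qed
  moreover have "surj u"
  proof (unfold surj_def, rule allI)
    fix x
    have "H x \<in> range G" using G(3) H(3) by blast
    then obtain t where "H x = G t" by blast
    then have "H x = H (u t)" by (simp add: Hu)
    then have "x = u t" using inj by (simp add: inj_eq)
    then show "\<exists>t. x = u t" ..
  qed
  moreover have "(u has_real_derivative F t / f (u t)) (at t)" for t
  proof -
    have "isCont R (H (u t))"
      by (rule isCont_inverse_function[of 1]) (simp_all add: RH DERIV_isCont[OF H(1)])
    then have cR: "isCont R (G t)" by (simp add: Hu)
    have "(R has_real_derivative inverse (f (u t))) (at (G t))"
    proof (rule DERIV_inverse_function[where f=H and a=0 and b="integral\<^sup>L lborel f"])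
      show "(H has_real_derivative f (u t)) (at (R (G t)))"
        using H(1)[of "u t"] by (simp add: u_def)
      show "f (u t) \<noteq> 0" using f(2)[of "u t"] by simp
    qed (use Gr HR cR in auto)
    from DERIV_chain[OF this G(1)] show ?thesis by (simp only: u_def divide_inverse mult.commute comp_def)
  qed
  ultimately show ?thesis by (intro exI[of _ u] conjI allI)
qed

text \<open>It suffices to test open intervals. Surjectivity writes the end points as
  \<open>u a\<close> and \<open>u b\<close>, monotonicity identifies the preimage with the interval
  from \<open>a\<close> to \<open>b\<close>, and the fundamental theorem of calculus gives its
  weighted length \<open>u b - u a\<close>.\<close>

lemma distr_density_monotone_surj:
  fixes u u' :: "real \<Rightarrow> real"
  assumes mono: "strict_mono u" and surj: "surj u"
    and deriv: "\<And>t. (u has_real_derivative u' t) (at t)"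
    and u': "u' \<in> borel_measurable borel" "\<And>t. 0 \<le> u' t"
  shows "distr (density lborel (\<lambda>t. ennreal (u' t))) borel u = lborel"
proof (rule lborel_eqI[symmetric])
  have "continuous_on UNIV u"
    using deriv by (intro continuous_at_imp_continuous_on ballI DERIV_isCont)
  then have u[measurable]: "u \<in> borel_measurable borel" by (rule borel_measurable_continuous_onI)
  note u'(1)[measurable]
  fix l r :: real assume "\<And>b. b \<in> Basis \<Longrightarrow> l \<bullet> b \<le> r \<bullet> b"
  then have lr: "l \<le> r" by simp
  obtain a b where ab: "l = u a" "r = u b" using surj by (metis surjD)
  have "a \<le> b" using lr ab mono by (simp add: strict_mono_less_eq)
  have vim: "u -` {l<..<r} = {a<..<b}" using ab mono by (auto simp: strict_mono_less)
  have "emeasure (distr (density lborel (\<lambda>t. ennreal (u' t))) borel u) {l<..<r}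
    = (\<integral>\<^sup>+t. ennreal (u' t) * indicator {a<..<b} t \<partial>lborel)"
    by (subst emeasure_distr) (auto simp: vim emeasure_density)
  also have "\<dots> = (\<integral>\<^sup>+t. ennreal (u' t) * indicator {a..b} t \<partial>lborel)"
    using AE_lborel_singleton[of a] AE_lborel_singleton[of b]
    by (intro nn_integral_cong_AE, eventually_elim) (auto split: split_indicator)
  also have "\<dots> = ennreal (u b - u a)"
    using \<open>a \<le> b\<close> by (intro nn_integral_FTC_Icc) (auto simp: u' deriv)
  finally show "emeasure (distr (density lborel (\<lambda>t. ennreal (u' t))) borel u) (box l r)
    = (\<Prod>b\<in>Basis. (r - l) \<bullet> b)"
    by (simp add: ab box_real)
qed simp

text \<open>The measurable inverse \<open>T\<close> belongs to the conclusion because the image of a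
  cell will be described as a preimage under \<open>T\<close>, which settles its
  measurability.\<close>

lemma affine_substitution:
  fixes \<beta> :: "nat \<Rightarrow> real"
  assumes B: "B \<in> carrier_mat k k" and det: "0 < Determinant.det B"
  defines "\<phi> \<equiv> \<lambda>Y. \<lambda>a\<in>{..<k}. mat_app B Y a + \<beta> a"
  shows "\<exists>T. T \<in> leb {..<k} \<rightarrow>\<^sub>M leb {..<k} \<and> (\<forall>Y\<in>space (leb {..<k}). T (\<phi> Y) = Y) \<and>
     (\<forall>z\<in>space (leb {..<k}). \<phi> (T z) = z) \<and>
     (\<forall>h\<in>borel_measurable (leb {..<k}).
        ennreal (Determinant.det B) * (\<integral>\<^sup>+Y. h (\<phi> Y) \<partial>leb {..<k}) = (\<integral>\<^sup>+z. h z \<partial>leb {..<k}))"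
proof -
  have "Determinant.det B \<noteq> 0" using det by simp
  then obtain B' where B': "B' \<in> carrier_mat k k" "B' * B = 1\<^sub>m k" "B * B' = 1\<^sub>m k"
    using det_non_zero_imp_unit[OF B, of "()"] by (auto simp: Units_def ring_mat_def)
  define T where "T = (\<lambda>z. mat_app B' (\<lambda>a\<in>{..<k}. z a - \<beta> a))"
  note measurable_mat_app[OF B, measurable] measurable_mat_app[OF B'(1), measurable]
  have T: "T \<in> leb {..<k} \<rightarrow>\<^sub>M leb {..<k}" unfolding T_def by measurable
  have app_space: "mat_app C Y \<in> space (leb {..<k})" if "C \<in> carrier_mat k k" for C Y
    using that by (auto simp: mat_app_def space_PiM)
  have 1: "T (\<phi> Y) = Y" if "Y \<in> space (leb {..<k})" for Y
  proof -
    have "(\<lambda>a\<in>{..<k}. \<phi> Y a - \<beta> a) = mat_app B Y"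
      using app_space[OF B, of Y] by (auto simp: \<phi>_def fun_eq_iff space_PiM PiE_def extensional_def)
    then show ?thesis
      unfolding T_def using that by (simp add: mat_app_mult[OF B'(1) B, symmetric] B'(2) mat_app_one)
  qed
  have 2: "\<phi> (T z) = z" if "z \<in> space (leb {..<k})" for z
  proof -
    have "(\<lambda>a\<in>{..<k}. z a - \<beta> a) \<in> space (leb {..<k})" by (auto simp: space_PiM)
    then have "mat_app B (T z) = (\<lambda>a\<in>{..<k}. z a - \<beta> a)"
      unfolding T_def by (simp add: mat_app_mult[OF B B'(1), symmetric] B'(3) mat_app_one)
    then show ?thesis using that by (auto simp: \<phi>_def fun_eq_iff space_PiM PiE_def extensional_def)
  qed
  have 3: "ennreal (Determinant.det B) * (\<integral>\<^sup>+Y. h (\<phi> Y) \<partial>leb {..<k}) = (\<integral>\<^sup>+z. h z \<partial>leb {..<k})"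
    if h[measurable]: "h \<in> borel_measurable (leb {..<k})" for h
  proof -
    have m: "(\<lambda>z. h (\<lambda>a\<in>{..<k}. z a + \<beta> a)) \<in> borel_measurable (leb {..<k})"
      by measurable
    have "ennreal (Determinant.det B) * (\<integral>\<^sup>+Y. h (\<phi> Y) \<partial>leb {..<k})
      = (\<integral>\<^sup>+z. h (\<lambda>a\<in>{..<k}. z a + \<beta> a) \<partial>leb {..<k})"
      using scales_leb_invertible[OF B \<open>Determinant.det B \<noteq> 0\<close>, unfolded scales_leb_def, rule_format, OF m] det
      by (simp add: \<phi>_def)
    also have "\<dots> = (\<integral>\<^sup>+z. h z \<partial>leb {..<k})"
      by (rule nn_integral_leb_translate) auto
    finally show ?thesis .
  qed
  show ?thesis using T 1 2 3 by blast
qed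

section \<open>Sums of ridge functions\<close>

text \<open>This is M diag(l) M^T, where \<open>w i\<close> is the \<open>i\<close>-th column of M.
  With \<open>l i\<close> the derivative of \<open>u i\<close> at \<open>ridge_arg k w b i Y\<close>
  it is the Jacobian matrix of \<open>ridge_map\<close> at \<open>Y\<close>.\<close>

definition gram_mat :: "nat \<Rightarrow> nat \<Rightarrow> (nat \<Rightarrow> nat \<Rightarrow> real) \<Rightarrow> (nat \<Rightarrow> real) \<Rightarrow> real Matrix.mat" where
  "gram_mat k m w l = Matrix.mat k k (\<lambda>(a, b). \<Sum>i<m. l i * w i a * w i b)"

definition ridge_arg :: "nat \<Rightarrow> (nat \<Rightarrow> nat \<Rightarrow> real) \<Rightarrow> (nat \<Rightarrow> real) \<Rightarrow> nat \<Rightarrow> (nat \<Rightarrow> real) \<Rightarrow> real" where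
  "ridge_arg k w b i Y = b i + (\<Sum>a<k. w i a * Y a)"

text \<open>The map \<open>Y \<mapsto> M u(M\<^sup>T Y + b)\<close>, where \<open>w i\<close> is the \<open>i\<close>-th column of \<open>M\<close>.\<close>

definition ridge_map :: "nat \<Rightarrow> nat \<Rightarrow> (nat \<Rightarrow> nat \<Rightarrow> real) \<Rightarrow> (nat \<Rightarrow> real) \<Rightarrow> (nat \<Rightarrow> real \<Rightarrow> real)
    \<Rightarrow> (nat \<Rightarrow> real) \<Rightarrow> nat \<Rightarrow> real" where
  "ridge_map k m w b u Y = (\<lambda>a\<in>{..<k}. \<Sum>i<m. u i (ridge_arg k w b i Y) * w i a)"

lemma measurable_ridge_arg [measurable]: "ridge_arg k w b i \<in> borel_measurable (leb {..<k})"
  unfolding ridge_arg_def[abs_def] by measurable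

lemma measurable_ridge_map:
  assumes [measurable]: "\<And>i. i < m \<Longrightarrow> u i \<in> borel_measurable borel"
  shows "ridge_map k m w b u \<in> leb {..<k} \<rightarrow>\<^sub>M leb {..<k}"
proof -
  have [measurable]: "(\<lambda>Y. u i (ridge_arg k w b i Y)) \<in> borel_measurable (leb {..<k})" if "i < m" for i
    using measurable_compose[OF measurable_ridge_arg assms[OF that]] .
  show ?thesis
    unfolding ridge_map_def[abs_def]
    by (intro measurable_restrict borel_measurable_sum borel_measurable_times, simp_all)
qed

text \<open>Injectivity is strict monotonicity: pair the difference of the images with \<open>Y - Y'\<close>.\<close>

lemma ridge_map_inj:
  assumes mono: "\<And>i. i < m \<Longrightarrow> strict_mono (u i)"
    and ker: "\<And>x. (\<forall>i<m. (\<Sum>a<k. w i a * x a) = 0) \<Longrightarrow> \<forall>a<k. x a = 0"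
    and Y: "Y \<in> space (leb {..<k})" "Y' \<in> space (leb {..<k})"
    and eq: "ridge_map k m w b u Y = ridge_map k m w b u Y'"
  shows "Y = Y'"
proof -
  define s where "s = (\<lambda>i. ridge_arg k w b i Y)"
  define s' where "s' = (\<lambda>i. ridge_arg k w b i Y')"
  have diff: "s i - s' i = (\<Sum>a<k. w i a * (Y a - Y' a))" for i
    by (simp add: s_def s'_def ridge_arg_def right_diff_distrib sum_subtractf)
  have "(\<Sum>i<m. (u i (s i) - u i (s' i)) * (s i - s' i))
      = (\<Sum>i<m. \<Sum>a<k. (u i (s i) * w i a - u i (s' i) * w i a) * (Y a - Y' a))"
    unfolding diff by (simp add: sum_distrib_left algebra_simps)
  also have "\<dots> = (\<Sum>a<k. (\<Sum>i<m. u i (s i) * w i a - u i (s' i) * w i a) * (Y a - Y' a))"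
    by (subst sum.swap) (simp add: sum_distrib_right)
  also have "\<dots> = 0"
  proof (rule sum.neutral, rule ballI)
    fix a assume "a \<in> {..<k}"
    then show "(\<Sum>i<m. u i (s i) * w i a - u i (s' i) * w i a) * (Y a - Y' a) = 0"
      using fun_cong[OF eq, of a] by (simp add: ridge_map_def s_def s'_def sum_subtractf)
  qed
  finally have sum0: "(\<Sum>i<m. (u i (s i) - u i (s' i)) * (s i - s' i)) = 0" .
  have pos: "0 < (u i (s i) - u i (s' i)) * (s i - s' i)" if "i < m" "s i \<noteq> s' i" for i
  proof (cases "s i < s' i")
    case True
    then show ?thesis using strict_mono_less[OF mono[OF that(1)]] by (intro mult_neg_neg) auto
  next
    case False
    then show ?thesis using that strict_mono_less[OF mono[OF that(1)], of "s' i" "s i"]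
      by (intro mult_pos_pos) auto
  qed
  have nonneg: "0 \<le> (u i (s i) - u i (s' i)) * (s i - s' i)" if "i < m" for i
    using pos[OF that] by (cases "s i = s' i") auto
  have "\<forall>i\<in>{..<m}. (u i (s i) - u i (s' i)) * (s i - s' i) = 0"
    using sum0 nonneg by (subst sum_nonneg_eq_0_iff[symmetric]) auto
  then have "s i = s' i" if "i < m" for i
    using pos[OF that] that by force
  then have "\<forall>i<m. (\<Sum>a<k. w i a * (Y a - Y' a)) = 0"
    by (simp flip: diff)
  then have *: "\<forall>a<k. Y a - Y' a = 0" by (rule ker)
  show ?thesis
  proof
    fix a show "Y a = Y' a"
      using * Y by (cases "a < k") (auto simp: space_PiM PiE_def extensional_def)
  qed
qed

text \<open>Only the values at the given \<open>Y\<close> enter, so the coefficients may change from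
  cell to cell. The image is M (al + diag(l) (b + M^T Y)), whose linear part is the Gram
  matrix.\<close>

lemma ridge_map_affine_on_cell:
  assumes "\<And>i. i < m \<Longrightarrow> u i (ridge_arg k w b i Y) = al i + l i * ridge_arg k w b i Y"
  shows "ridge_map k m w b u Y =
    (\<lambda>a\<in>{..<k}. mat_app (gram_mat k m w l) Y a + (\<Sum>i<m. (al i + l i * b i) * w i a))"
proof
  fix a
  show "ridge_map k m w b u Y a =
    (\<lambda>a\<in>{..<k}. mat_app (gram_mat k m w l) Y a + (\<Sum>i<m. (al i + l i * b i) * w i a)) a"
  proof (cases "a < k")
    case True
    have "(\<Sum>j<k. (\<Sum>i<m. l i * w i a * w i j) * Y j) = (\<Sum>i<m. \<Sum>j<k. l i * w i a * w i j * Y j)"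
      by (subst sum.swap) (simp add: sum_distrib_right)
    also have "\<dots> = (\<Sum>i<m. l i * (\<Sum>j<k. w i j * Y j) * w i a)"
      by (simp add: sum_distrib_left sum_distrib_right algebra_simps)
    finally have "mat_app (gram_mat k m w l) Y a = (\<Sum>i<m. l i * (\<Sum>j<k. w i j * Y j) * w i a)"
      using True by (simp add: mat_app_def gram_mat_def)
    moreover have "ridge_map k m w b u Y a = (\<Sum>i<m. (al i + l i * (b i + (\<Sum>j<k. w i j * Y j))) * w i a)"
      using True assms by (simp add: ridge_map_def ridge_arg_def)
    ultimately show ?thesis using True
      by (simp add: sum.distrib[symmetric] algebra_simps)
  qed (simp add: ridge_map_def)
qed

section \<open>Change of variables for piecewise affine ridge maps\<close>

lemma nn_integral_split_nat:
  fixes N :: "'a \<Rightarrow> nat"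
  assumes [measurable]: "N \<in> measurable M (count_space UNIV)" "g \<in> borel_measurable M"
  shows "(\<integral>\<^sup>+x. g x \<partial>M) = (\<Sum>n. \<integral>\<^sup>+x. g x * indicator {n} (N x) \<partial>M)"
proof -
  have [measurable]: "(\<lambda>x. indicator {n} (N x) :: ennreal) \<in> borel_measurable M" for n
    using measurable_compose[OF assms(1), of "indicator {n}" borel] by simp
  have "(\<integral>\<^sup>+x. g x \<partial>M) = (\<integral>\<^sup>+x. (\<Sum>n. g x * indicator {n} (N x)) \<partial>M)"
  proof (rule nn_integral_cong)
    fix x
    have "(\<Sum>n. g x * indicator {n} (N x)) = (\<Sum>n\<in>{N x}. g x * indicator {n} (N x))"
      by (rule suminf_finite) auto
    then show "g x = (\<Sum>n. g x * indicator {n} (N x))" by simp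
  qed
  also have "\<dots> = (\<Sum>n. \<integral>\<^sup>+x. g x * indicator {n} (N x) \<partial>M)"
    by (rule nn_integral_suminf) measurable
  finally show ?thesis .
qed

text \<open>
  The library's change of variables theorem lives on types of fixed dimension, whereas here the dimension
  \<open>k\<close> is a variable. For piecewise affine \<open>u\<^sub>i\<close> linear substitutions suffice: the map is affine on countably many
  cells whose images are disjoint by injectivity. General \<open>u\<^sub>i\<close> are then reached by secant interpolation
  and Fatou's lemma, which is why the integrand \<open>G\<close> has to be lower semicontinuous below.
\<close>

lemma piecewise_affine_substitution:
  fixes q :: "real \<Rightarrow> int"
  assumes q[measurable]: "q \<in> measurable borel (count_space UNIV)"
    and U: "\<And>i t. i < m \<Longrightarrow> U i t = al i (q t) + sl i (q t) * t"
    and Um[measurable]: "\<And>i. i < m \<Longrightarrow> U i \<in> borel_measurable borel"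
    and mono: "\<And>i. i < m \<Longrightarrow> strict_mono (U i)"
    and sl: "\<And>i j. i < m \<Longrightarrow> 0 < sl i j"
    and ker: "\<And>x. (\<forall>i<m. (\<Sum>a<k. w i a * x a) = 0) \<Longrightarrow> \<forall>a<k. x a = 0"
    and gram: "\<And>l. (\<forall>i<m. 0 < l i) \<Longrightarrow> 0 < Determinant.det (gram_mat k m w l)"
    and G[measurable]: "G \<in> borel_measurable (leb {..<k})"
  shows "(\<integral>\<^sup>+Y. ennreal (Determinant.det (gram_mat k m w (\<lambda>i. sl i (q (ridge_arg k w b i Y))))) *
      G (ridge_map k m w b U Y) \<partial>leb {..<k}) \<le> (\<integral>\<^sup>+z. G z \<partial>leb {..<k})"
proof -
  \<comment> \<open>A cell is labelled by the list of the grid indices of all \<open>m\<close>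
    arguments; coding this list as a natural number turns the decomposition into a series.\<close>
  define idx where "idx = (\<lambda>Y. map (\<lambda>i. q (ridge_arg k w b i Y)) [0..<m])"
  define N where "N = (\<lambda>Y. to_nat (idx Y))"
  define L where "L = (\<lambda>n i. sl i ((from_nat n :: int list) ! i))"
  define B where "B = (\<lambda>n. gram_mat k m w (L n))"
  define \<beta> where "\<beta> = (\<lambda>n a. \<Sum>i<m. (al i ((from_nat n :: int list) ! i) + L n i * b i) * w i a)"
  define \<phi> where "\<phi> = (\<lambda>n Y. \<lambda>a\<in>{..<k}. mat_app (B n) Y a + \<beta> n a)"
  let ?\<Phi> = "ridge_map k m w b U"
  define J where "J = (\<lambda>Y. Determinant.det (gram_mat k m w (\<lambda>i. sl i (q (ridge_arg k w b i Y)))))"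
  have on_cell: "?\<Phi> Y = \<phi> n Y" "J Y = Determinant.det (B n)" if "N Y = n" for Y n
  proof -
    have idx_n: "(from_nat n :: int list) = idx Y" using that by (auto simp: N_def)
    then have nth: "(from_nat n :: int list) ! i = q (ridge_arg k w b i Y)" if "i < m" for i
      using that by (simp add: idx_def)
    show "?\<Phi> Y = \<phi> n Y"
      unfolding \<phi>_def \<beta>_def B_def
      by (rule ridge_map_affine_on_cell) (simp add: U L_def nth)
    have "gram_mat k m w (\<lambda>i. sl i (q (ridge_arg k w b i Y))) = B n"
      unfolding B_def gram_mat_def L_def by (rule eq_matI) (simp_all add: nth)
    then show "J Y = Determinant.det (B n)" by (simp add: J_def)
  qed
  \<comment> \<open>Each label imposes finitely many measurable conditions on \<open>Y\<close>; a
    number that codes no list of length \<open>m\<close> has an empty fibre.\<close>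
  have N_meas[measurable]: "N \<in> measurable (leb {..<k}) (count_space UNIV)"
  proof (rule measurable_count_space_eq2_countable[THEN iffD2, rule_format], intro conjI ballI)
    fix n
    have "N Y = n \<longleftrightarrow> to_nat (from_nat n :: int list) = n \<and> length (from_nat n :: int list) = m \<and>
        (\<forall>i\<in>{..<m}. q (ridge_arg k w b i Y) = (from_nat n :: int list) ! i)" for Y
    proof
      assume "N Y = n"
      then have idx_n: "(from_nat n :: int list) = idx Y" by (auto simp: N_def)
      then show "to_nat (from_nat n :: int list) = n \<and> length (from_nat n :: int list) = m \<and>
        (\<forall>i\<in>{..<m}. q (ridge_arg k w b i Y) = (from_nat n :: int list) ! i)"
        using \<open>N Y = n\<close> by (simp add: N_def idx_def)
    next
      assume *: "to_nat (from_nat n :: int list) = n \<and> length (from_nat n :: int list) = m \<and>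
        (\<forall>i\<in>{..<m}. q (ridge_arg k w b i Y) = (from_nat n :: int list) ! i)"
      then have "idx Y = from_nat n"
        by (intro nth_equalityI) (simp_all add: idx_def)
      then show "N Y = n" using * by (simp add: N_def)
    qed
    then have "N -` {n} \<inter> space (leb {..<k}) = {Y \<in> space (leb {..<k}).
        to_nat (from_nat n :: int list) = n \<and> length (from_nat n :: int list) = m \<and>
        (\<forall>i\<in>{..<m}. q (ridge_arg k w b i Y) = (from_nat n :: int list) ! i)}"
      by auto
    also have "\<dots> \<in> sets (leb {..<k})" by measurable
    finally show "N -` {n} \<inter> space (leb {..<k}) \<in> sets (leb {..<k})" .
  qed auto
  have detB: "0 < Determinant.det (B n)" for n
    unfolding B_def by (rule gram) (simp add: L_def sl)
  have cB: "B n \<in> carrier_mat k k" for n by (simp add: B_def gram_mat_def)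
  have "\<exists>T. \<forall>n. T n \<in> leb {..<k} \<rightarrow>\<^sub>M leb {..<k} \<and> (\<forall>Y\<in>space (leb {..<k}). T n (\<phi> n Y) = Y) \<and>
     (\<forall>z\<in>space (leb {..<k}). \<phi> n (T n z) = z) \<and>
     (\<forall>h\<in>borel_measurable (leb {..<k}).
        ennreal (Determinant.det (B n)) * (\<integral>\<^sup>+Y. h (\<phi> n Y) \<partial>leb {..<k}) = (\<integral>\<^sup>+z. h z \<partial>leb {..<k}))"
    unfolding \<phi>_def by (rule choice) (intro allI affine_substitution cB detB)
  then obtain T where T: "\<And>n. T n \<in> leb {..<k} \<rightarrow>\<^sub>M leb {..<k}"
    and T\<phi>: "\<And>n Y. Y \<in> space (leb {..<k}) \<Longrightarrow> T n (\<phi> n Y) = Y"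
    and \<phi>T: "\<And>n z. z \<in> space (leb {..<k}) \<Longrightarrow> \<phi> n (T n z) = z"
    and sub: "\<And>n h. h \<in> borel_measurable (leb {..<k}) \<Longrightarrow>
        ennreal (Determinant.det (B n)) * (\<integral>\<^sup>+Y. h (\<phi> n Y) \<partial>leb {..<k}) = (\<integral>\<^sup>+z. h z \<partial>leb {..<k})"
    by metis
  note T[measurable]
  have \<Phi>[measurable]: "?\<Phi> \<in> leb {..<k} \<rightarrow>\<^sub>M leb {..<k}"
    by (rule measurable_ridge_map) (rule Um)
  have [measurable]: "\<phi> n \<in> leb {..<k} \<rightarrow>\<^sub>M leb {..<k}" for n
  proof -
    have "(\<lambda>z. \<lambda>a\<in>{..<k}. z a + \<beta> n a) \<in> leb {..<k} \<rightarrow>\<^sub>M leb {..<k}" by measurable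
    from measurable_compose[OF measurable_mat_app[OF cB] this] show ?thesis unfolding \<phi>_def .
  qed
  have J_meas[measurable]: "(\<lambda>Y. ennreal (J Y)) \<in> borel_measurable (leb {..<k})"
  proof -
    have "(\<lambda>Y. ennreal (Determinant.det (B (N Y)))) \<in> borel_measurable (leb {..<k})"
      using measurable_compose[OF N_meas, of "\<lambda>n. ennreal (Determinant.det (B n))" borel] by simp
    then show ?thesis by (simp add: on_cell(2)[OF refl])
  qed
  \<comment> \<open>\<open>h n\<close> is \<open>G\<close> cut off to the image of cell
    \<open>n\<close>: a point \<open>z\<close> lies in that image exactly when \<open>T n z\<close>,
    its preimage under the \<open>n\<close>-th affine map, falls into cell \<open>n\<close>.\<close>
  define h where "h = (\<lambda>n z. G z * indicator {n} (N (T n z)))"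
  have [measurable]: "(\<lambda>Y. indicator {n} (N Y) :: ennreal) \<in> borel_measurable (leb {..<k})" for n
    using measurable_compose[OF N_meas, of "indicator {n}" borel] by simp
  have h[measurable]: "h n \<in> borel_measurable (leb {..<k})" for n
    unfolding h_def by measurable
  have "(\<integral>\<^sup>+Y. ennreal (J Y) * G (?\<Phi> Y) \<partial>leb {..<k})
      = (\<Sum>n. \<integral>\<^sup>+Y. ennreal (J Y) * G (?\<Phi> Y) * indicator {n} (N Y) \<partial>leb {..<k})"
    by (rule nn_integral_split_nat) measurable
  also have "\<dots> = (\<Sum>n. \<integral>\<^sup>+z. h n z \<partial>leb {..<k})"
  proof (rule suminf_cong)
    fix n
    have "(\<integral>\<^sup>+Y. ennreal (J Y) * G (?\<Phi> Y) * indicator {n} (N Y) \<partial>leb {..<k})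
      = (\<integral>\<^sup>+Y. ennreal (Determinant.det (B n)) * h n (\<phi> n Y) \<partial>leb {..<k})"
    proof (rule nn_integral_cong)
      fix Y assume "Y \<in> space (leb {..<k})"
      then show "ennreal (J Y) * G (?\<Phi> Y) * indicator {n} (N Y) =
          ennreal (Determinant.det (B n)) * h n (\<phi> n Y)"
        by (cases "N Y = n") (simp_all add: h_def T\<phi> on_cell)
    qed
    also have "\<dots> = ennreal (Determinant.det (B n)) * (\<integral>\<^sup>+Y. h n (\<phi> n Y) \<partial>leb {..<k})"
      by (rule nn_integral_cmult) measurable
    also have "\<dots> = (\<integral>\<^sup>+z. h n z \<partial>leb {..<k})" by (rule sub) measurable
    finally show "(\<integral>\<^sup>+Y. ennreal (J Y) * G (?\<Phi> Y) * indicator {n} (N Y) \<partial>leb {..<k}) =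
      (\<integral>\<^sup>+z. h n z \<partial>leb {..<k})" .
  qed
  also have "\<dots> = (\<integral>\<^sup>+z. (\<Sum>n. h n z) \<partial>leb {..<k})"
    by (rule nn_integral_suminf[symmetric]) measurable
  also have "\<dots> \<le> (\<integral>\<^sup>+z. G z \<partial>leb {..<k})"
  proof (rule nn_integral_mono)
    fix z assume z: "z \<in> space (leb {..<k})"
    \<comment> \<open>If \<open>z\<close> lay in the images of two cells, \<open>T n z\<close> and
      \<open>T n' z\<close> would be two preimages of \<open>z\<close> under \<open>?\<Phi>\<close>.
      Injectivity identifies them and hence their labels, so at most one term of the series is
      nonzero.\<close>
    have uniq: "n = n'" if "N (T n z) = n" "N (T n' z) = n'" for n n'
    proof -
      have "T n z = T n' z"
      proof (rule ridge_map_inj[where u=U and m=m and w=w and k=k and b=b])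
        show "?\<Phi> (T n z) = ?\<Phi> (T n' z)"
          using on_cell(1)[OF that(1)] on_cell(1)[OF that(2)] \<phi>T[OF z] by simp
        show "strict_mono (U i)" if "i < m" for i using that by (rule mono)
        show "\<forall>a<k. x a = 0" if "\<forall>i<m. (\<Sum>a<k. w i a * x a) = 0" for x
          using that by (rule ker)
      qed (rule measurable_space[OF T z])+
      from arg_cong[OF this, of N] show ?thesis unfolding that .
    qed
    show "(\<Sum>n. h n z) \<le> G z"
    proof (cases "\<exists>n. N (T n z) = n")
      case True
      then obtain n where n: "N (T n z) = n" by blast
      have "(\<Sum>j. h j z) = (\<Sum>j\<in>{n}. h j z)"
        using uniq[OF n] by (intro suminf_finite) (auto simp: h_def indicator_def)
      then show ?thesis using n by (simp add: h_def)
    next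
      case False
      then have "h n z = 0" for n by (auto simp: h_def indicator_def)
      then show ?thesis by simp
    qed
  qed
  finally show ?thesis by (simp add: J_def)
qed

text \<open>The infima of the tails increase to the limits inferior, and their product converges
  because \<open>c\<close> is positive and finite, which excludes the indeterminate product of 0 and
  \<infinity>.\<close>

lemma liminf_mult_ge:
  fixes b :: "nat \<Rightarrow> ennreal" and a :: "nat \<Rightarrow> real"
  assumes a: "a \<longlonglongrightarrow> c" "0 < c"
  shows "ennreal c * liminf b \<le> liminf (\<lambda>n. ennreal (a n) * b n)"
proof -
  define A where "A = (\<lambda>n. INF m\<in>{n..}. ennreal (a m))"
  define B where "B = (\<lambda>n. INF m\<in>{n..}. b m)"
  have inc: "incseq A" "incseq B"
    unfolding A_def B_def by (auto intro!: incseq_SucI INF_superset_mono)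
  have "(SUP n. A n) = liminf (\<lambda>n. ennreal (a n))" by (simp add: A_def liminf_SUP_INF)
  also have "\<dots> = ennreal c"
    using a by (intro lim_imp_Liminf tendsto_ennrealI) auto
  finally have "A \<longlonglongrightarrow> ennreal c" using LIMSEQ_SUP[OF inc(1)] by simp
  moreover have "B \<longlonglongrightarrow> liminf b"
    using LIMSEQ_SUP[OF inc(2)] by (simp add: B_def liminf_SUP_INF)
  ultimately have "(\<lambda>n. A n * B n) \<longlonglongrightarrow> ennreal c * liminf b"
    using a by (intro tendsto_mult_ennreal) auto
  moreover have "A n * B n \<le> (INF m\<in>{n..}. ennreal (a m) * b m)" for n
    by (rule INF_greatest) (auto simp: A_def B_def intro!: mult_mono INF_lower)
  then have "A n * B n \<le> liminf (\<lambda>n. ennreal (a n) * b n)" for n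
    unfolding liminf_SUP_INF by (rule SUP_upper2[OF UNIV_I])
  ultimately show ?thesis by (intro LIMSEQ_le_const2) auto
qed

section \<open>Secant interpolation on a uniform grid\<close>

definition secant_slope :: "nat \<Rightarrow> (real \<Rightarrow> real) \<Rightarrow> int \<Rightarrow> real" where
  "secant_slope N u j = (u ((of_int j + 1) / real (Suc N)) - u (of_int j / real (Suc N))) * real (Suc N)"

text \<open>Each affine piece is stored by intercept and slope, the form that
  \<open>piecewise_affine_substitution\<close> expects. The mesh is 1/(N+1), so \<open>N = 0\<close>
  causes no division by zero.\<close>

definition secant_icpt :: "nat \<Rightarrow> (real \<Rightarrow> real) \<Rightarrow> int \<Rightarrow> real" where
  "secant_icpt N u j = u (of_int j / real (Suc N)) - secant_slope N u j * (of_int j / real (Suc N))"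

definition grid_cell :: "nat \<Rightarrow> real \<Rightarrow> int" where
  "grid_cell N t = \<lfloor>t * real (Suc N)\<rfloor>"

definition secant_interp :: "nat \<Rightarrow> (real \<Rightarrow> real) \<Rightarrow> real \<Rightarrow> real" where
  "secant_interp N u t = secant_icpt N u (grid_cell N t) + secant_slope N u (grid_cell N t) * t"

lemma grid_cell_bounds:
  "of_int (grid_cell N t) / real (Suc N) \<le> t" "t < (of_int (grid_cell N t) + 1) / real (Suc N)"
proof -
  have "of_int (grid_cell N t) \<le> t * real (Suc N)" "t * real (Suc N) < of_int (grid_cell N t) + 1"
    unfolding grid_cell_def by linarith+
  then show "of_int (grid_cell N t) / real (Suc N) \<le> t" "t < (of_int (grid_cell N t) + 1) / real (Suc N)"
    by (simp_all add: pos_divide_le_eq pos_less_divide_eq del: of_nat_Suc)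
qed

lemma grid_cell_tendsto:
  "(\<lambda>N. of_int (grid_cell N t) / real (Suc N)) \<longlonglongrightarrow> t"
proof (rule tendsto_sandwich)
  show "\<forall>\<^sub>F N in sequentially. t - 1 / real (Suc N) \<le> of_int (grid_cell N t) / real (Suc N)"
  proof (intro always_eventually allI)
    fix N
    show "t - 1 / real (Suc N) \<le> of_int (grid_cell N t) / real (Suc N)"
      using grid_cell_bounds(2)[of t N] by (simp add: add_divide_distrib del: of_nat_Suc)
  qed
  show "(\<lambda>N. t - 1 / real (Suc N)) \<longlonglongrightarrow> t"
    using tendsto_diff[OF tendsto_const[of t] LIMSEQ_Suc[OF lim_1_over_n]] by simp
qed (auto simp: grid_cell_bounds simp del: of_nat_Suc)

lemma secant_interp_eq:
  "secant_interp N u t = u (of_int (grid_cell N t) / real (Suc N)) + secant_slope N u (grid_cell N t) * (t - of_int (grid_cell N t) / real (Suc N))"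
  unfolding secant_interp_def secant_icpt_def by (simp add: right_diff_distrib del: of_nat_Suc)

lemma secant_slope_pos:
  assumes "strict_mono u" shows "0 < secant_slope N u j"
proof -
  have "u (of_int j / real (Suc N)) < u ((of_int j + 1) / real (Suc N))"
    by (rule strict_monoD[OF assms], rule divide_strict_right_mono) simp_all
  then show ?thesis unfolding secant_slope_def by simp
qed

text \<open>Within one cell the slope is positive. Across cells the comparison passes through grid
  points, where the interpolant agrees with \<open>u\<close>: the right end of the cell of
  \<open>s\<close> does not exceed the left end of the cell of \<open>t\<close>.\<close>

lemma strict_mono_secant_interp:
  assumes u: "strict_mono u" shows "strict_mono (secant_interp N u)"
proof (rule strict_monoI)
  fix s t :: real assume st: "s < t"
  let ?g = "\<lambda>j::int. of_int j / real (Suc N)"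
  have le: "grid_cell N s \<le> grid_cell N t"
    unfolding grid_cell_def using st by (intro floor_mono mult_right_mono) auto
  show "secant_interp N u s < secant_interp N u t"
  proof (cases "grid_cell N s = grid_cell N t")
    case True
    then show ?thesis using st secant_slope_pos[OF u] by (simp add: secant_interp_def)
  next
    case False
    with le have "of_int (grid_cell N s) + 1 \<le> real_of_int (grid_cell N t)" by linarith
    then have le': "(of_int (grid_cell N s) + 1) / real (Suc N) \<le> ?g (grid_cell N t)"
      by (intro divide_right_mono) auto
    have "secant_interp N u s < u (?g (grid_cell N s)) + secant_slope N u (grid_cell N s) *
        ((of_int (grid_cell N s) + 1) / real (Suc N) - ?g (grid_cell N s))"
      unfolding secant_interp_eq using grid_cell_bounds(2)[of s N] secant_slope_pos[OF u, of N "grid_cell N s"]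
      by (intro add_strict_left_mono mult_strict_left_mono diff_strict_right_mono)
    also have "\<dots> = u ((of_int (grid_cell N s) + 1) / real (Suc N))"
      unfolding secant_slope_def by (simp add: add_divide_distrib del: of_nat_Suc)
    also have "\<dots> \<le> u (?g (grid_cell N t))"
      using le' strict_mono_less_eq[OF u] by simp
    also have "\<dots> \<le> secant_interp N u t"
      unfolding secant_interp_eq using grid_cell_bounds(1)[of N t] secant_slope_pos[OF u, of N "grid_cell N t"] by simp
    finally show ?thesis .
  qed
qed

text \<open>By the mean value theorem the slope is \<open>u'\<close> at some point of the cell. The
  cells shrink to \<open>t\<close>, and continuity of \<open>u'\<close> at \<open>t\<close>
  concludes.\<close>

lemma secant_slope_tendsto:
  assumes deriv: "\<And>t. (u has_real_derivative u' t) (at t)" and cont: "continuous_on UNIV u'"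
  shows "(\<lambda>N. secant_slope N u (grid_cell N t)) \<longlonglongrightarrow> u' t"
proof -
  let ?g = "\<lambda>N. of_int (grid_cell N t) / real (Suc N)"
  have "\<exists>\<xi>. ?g N < \<xi> \<and> \<xi> < ?g N + 1 / real (Suc N) \<and> secant_slope N u (grid_cell N t) = u' \<xi>" for N
  proof -
    have "?g N < ?g N + 1 / real (Suc N)" by simp
    from MVT2[OF this, of u u'] obtain \<xi> where \<xi>: "?g N < \<xi>" "\<xi> < ?g N + 1 / real (Suc N)"
      "u (?g N + 1 / real (Suc N)) - u (?g N) = (?g N + 1 / real (Suc N) - ?g N) * u' \<xi>"
      using deriv by metis
    from \<xi>(3) have "secant_slope N u (grid_cell N t) = u' \<xi>"
      unfolding secant_slope_def by (simp add: add_divide_distrib del: of_nat_Suc)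
    with \<xi> show ?thesis by blast
  qed
  then obtain \<xi> where \<xi>: "\<And>N. ?g N < \<xi> N" "\<And>N. \<xi> N < ?g N + 1 / real (Suc N)"
    "\<And>N. secant_slope N u (grid_cell N t) = u' (\<xi> N)"
    by metis
  have "\<xi> \<longlonglongrightarrow> t"
  proof (rule tendsto_sandwich[OF _ _ grid_cell_tendsto])
    show "(\<lambda>N. ?g N + 1 / real (Suc N)) \<longlonglongrightarrow> t"
      using tendsto_add[OF grid_cell_tendsto[of t] LIMSEQ_Suc[OF lim_1_over_n]] by simp
  qed (use \<xi> in \<open>auto intro!: always_eventually less_imp_le simp del: of_nat_Suc\<close>)
  moreover have "isCont u' t" using cont by (simp add: continuous_on_eq_continuous_at)
  ultimately show ?thesis unfolding \<xi>(3) by (metis isCont_tendsto_compose)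
qed

lemma secant_interp_tendsto:
  assumes deriv: "\<And>t. (u has_real_derivative u' t) (at t)" and cont: "continuous_on UNIV u'"
  shows "(\<lambda>N. secant_interp N u t) \<longlonglongrightarrow> u t"
proof -
  have "isCont u t" by (rule DERIV_isCont) (rule deriv)
  then have "(\<lambda>N. u (of_int (grid_cell N t) / real (Suc N))) \<longlonglongrightarrow> u t"
    by (rule isCont_tendsto_compose) (rule grid_cell_tendsto)
  then have "(\<lambda>N. secant_interp N u t) \<longlonglongrightarrow> u t + u' t * (t - t)"
    unfolding secant_interp_eq
    by (intro tendsto_add tendsto_mult secant_slope_tendsto[OF deriv cont] tendsto_diff tendsto_const grid_cell_tendsto)
  then show ?thesis by simp
qed

text \<open>By the Leibniz formula the determinant is a polynomial in the entries; the measurability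
  lemma that follows rests on the same expansion.\<close>

lemma tendsto_det:
  fixes A :: "'b \<Rightarrow> real Matrix.mat"
  assumes car: "\<And>n. A n \<in> carrier_mat k k" "L \<in> carrier_mat k k"
    and lim: "\<And>a b. a < k \<Longrightarrow> b < k \<Longrightarrow> ((\<lambda>n. A n $$ (a, b)) \<longlongrightarrow> L $$ (a, b)) F"
  shows "((\<lambda>n. Determinant.det (A n)) \<longlongrightarrow> Determinant.det L) F"
proof -
  have "((\<lambda>n. \<Sum>p | p permutes {0..<k}. signof p * (\<Prod>i = 0..<k. A n $$ (i, p i))) \<longlongrightarrow>
      (\<Sum>p | p permutes {0..<k}. signof p * (\<Prod>i = 0..<k. L $$ (i, p i)))) F"
  proof (intro tendsto_sum tendsto_mult tendsto_const tendsto_prod lim)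
    fix p i assume "p \<in> {p. p permutes {0..<k}}" "i \<in> {0..<k}"
    then show "i < k" "p i < k" using permutes_in_image[of p "{0..<k}" i] by auto
  qed
  then show ?thesis
    using Determinant.det_def'[OF car(1)] Determinant.det_def'[OF car(2)] by simp
qed

lemma borel_measurable_det:
  fixes A :: "'b \<Rightarrow> real Matrix.mat"
  assumes car: "\<And>x. A x \<in> carrier_mat k k"
    and meas: "\<And>a b. a < k \<Longrightarrow> b < k \<Longrightarrow> (\<lambda>x. A x $$ (a, b)) \<in> borel_measurable M"
  shows "(\<lambda>x. Determinant.det (A x)) \<in> borel_measurable M"
proof -
  have "(\<lambda>x. \<Sum>p | p permutes {0..<k}. signof p * (\<Prod>i = 0..<k. A x $$ (i, p i))) \<in> borel_measurable M"
  proof (intro borel_measurable_sum borel_measurable_times borel_measurable_const borel_measurable_prod meas)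
    fix p i assume "p \<in> {p. p permutes {0..<k}}" "i \<in> {0..<k}"
    then show "i < k" "p i < k" using permutes_in_image[of p "{0..<k}" i] by auto
  qed
  then show ?thesis using Determinant.det_def'[OF car] by simp
qed

text \<open>Every secant interpolant is strictly increasing with positive slopes, so it satisfies
  the bound with the same right-hand side. Passing to the limit then needs only pointwise
  convergence of the maps and of their Jacobians.\<close>

lemma ridge_substitution_le:
  assumes mono: "\<And>i. i < m \<Longrightarrow> strict_mono (u i)"
    and deriv: "\<And>i t. i < m \<Longrightarrow> (u i has_real_derivative u' i t) (at t)"
    and cont: "\<And>i. i < m \<Longrightarrow> continuous_on UNIV (u' i)"
    and pos: "\<And>i t. i < m \<Longrightarrow> 0 < u' i t"
    and ker: "\<And>x. (\<forall>i<m. (\<Sum>a<k. w i a * x a) = 0) \<Longrightarrow> \<forall>a<k. x a = 0"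
    and gram: "\<And>l. (\<forall>i<m. 0 < l i) \<Longrightarrow> 0 < Determinant.det (gram_mat k m w l)"
    and G[measurable]: "G \<in> borel_measurable (leb {..<k})"
    and lsc: "\<And>z Z. (\<forall>N. Z N \<in> space (leb {..<k})) \<Longrightarrow> z \<in> space (leb {..<k}) \<Longrightarrow>
        (\<forall>a<k. (\<lambda>N. Z N a) \<longlonglongrightarrow> z a) \<Longrightarrow> G z \<le> liminf (\<lambda>N. G (Z N))"
  shows "(\<integral>\<^sup>+Y. ennreal (Determinant.det (gram_mat k m w (\<lambda>i. u' i (ridge_arg k w b i Y)))) *
      G (ridge_map k m w b u Y) \<partial>leb {..<k}) \<le> (\<integral>\<^sup>+z. G z \<partial>leb {..<k})"
proof -
  define J where "J = (\<lambda>N Y. Determinant.det (gram_mat k m w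
      (\<lambda>i. secant_slope N (u i) (grid_cell N (ridge_arg k w b i Y)))))"
  define \<Phi> where "\<Phi> = (\<lambda>N. ridge_map k m w b (\<lambda>i. secant_interp N (u i)))"
  have [measurable]: "grid_cell N \<in> measurable borel (count_space UNIV)" for N
    unfolding grid_cell_def[abs_def] by measurable
  have secant_interp_meas[measurable]: "secant_interp N (u i) \<in> borel_measurable borel" if "i < m" for N i
    unfolding secant_interp_def[abs_def] by measurable
  have \<Phi>_meas[measurable]: "\<Phi> N \<in> leb {..<k} \<rightarrow>\<^sub>M leb {..<k}" for N
    unfolding \<Phi>_def by (rule measurable_ridge_map) (rule secant_interp_meas)
  have J_meas[measurable]: "J N \<in> borel_measurable (leb {..<k})" for N
  proof -
    have [measurable]: "(\<lambda>Y. secant_slope N (u i) (grid_cell N (ridge_arg k w b i Y))) \<in> borel_measurable (leb {..<k})" for i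
      by measurable
    show ?thesis unfolding J_def
      by (rule borel_measurable_det[where k=k]) (simp_all add: gram_mat_def)
  qed
  have slope_lim: "(\<lambda>N. secant_slope N (u i) (grid_cell N t)) \<longlonglongrightarrow> u' i t" if "i < m" for i t
    using secant_slope_tendsto[OF deriv cont] that by blast
  have secant_interp_lim: "(\<lambda>N. secant_interp N (u i) t) \<longlonglongrightarrow> u i t" if "i < m" for i t
    using secant_interp_tendsto[OF deriv cont] that by blast
  have "(\<integral>\<^sup>+Y. ennreal (Determinant.det (gram_mat k m w (\<lambda>i. u' i (ridge_arg k w b i Y)))) *
      G (ridge_map k m w b u Y) \<partial>leb {..<k})
    \<le> (\<integral>\<^sup>+Y. liminf (\<lambda>N. ennreal (J N Y) * G (\<Phi> N Y)) \<partial>leb {..<k})"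
  proof (rule nn_integral_mono)
    fix Y assume Y: "Y \<in> space (leb {..<k})"
    let ?c = "Determinant.det (gram_mat k m w (\<lambda>i. u' i (ridge_arg k w b i Y)))"
    have "(\<lambda>N. J N Y) \<longlonglongrightarrow> ?c"
      unfolding J_def
    proof (rule tendsto_det)
      fix a a' assume "a < k" "a' < k"
      then show "(\<lambda>N. gram_mat k m w (\<lambda>i. secant_slope N (u i) (grid_cell N (ridge_arg k w b i Y))) $$ (a, a'))
          \<longlonglongrightarrow> gram_mat k m w (\<lambda>i. u' i (ridge_arg k w b i Y)) $$ (a, a')"
        by (simp add: gram_mat_def)
          (intro tendsto_sum tendsto_mult tendsto_const slope_lim; simp)
    qed (simp_all add: gram_mat_def)
    moreover have "0 < ?c" by (rule gram) (simp add: pos)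
    ultimately have "ennreal ?c * liminf (\<lambda>N. G (\<Phi> N Y)) \<le> liminf (\<lambda>N. ennreal (J N Y) * G (\<Phi> N Y))"
      by (rule liminf_mult_ge)
    moreover have "G (ridge_map k m w b u Y) \<le> liminf (\<lambda>N. G (\<Phi> N Y))"
    proof (rule lsc)
      show "\<forall>a<k. (\<lambda>N. \<Phi> N Y a) \<longlonglongrightarrow> ridge_map k m w b u Y a"
        unfolding \<Phi>_def ridge_map_def
        by (simp, intro allI impI tendsto_sum tendsto_mult tendsto_const secant_interp_lim; simp)
    qed (auto simp: \<Phi>_def ridge_map_def space_PiM)
    ultimately show "ennreal ?c * G (ridge_map k m w b u Y) \<le> liminf (\<lambda>N. ennreal (J N Y) * G (\<Phi> N Y))"
      by (meson mult_left_mono order_trans zero_le)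
  qed
  also have "\<dots> \<le> liminf (\<lambda>N. \<integral>\<^sup>+Y. ennreal (J N Y) * G (\<Phi> N Y) \<partial>leb {..<k})"
    by (rule nn_integral_liminf) measurable
  also have "\<dots> \<le> liminf (\<lambda>N::nat. \<integral>\<^sup>+z. G z \<partial>leb {..<k})"
  proof (rule Liminf_mono, rule always_eventually, rule allI)
    fix N
    show "(\<integral>\<^sup>+Y. ennreal (J N Y) * G (\<Phi> N Y) \<partial>leb {..<k}) \<le> (\<integral>\<^sup>+z. G z \<partial>leb {..<k})"
      unfolding J_def \<Phi>_def
    proof (rule piecewise_affine_substitution[where U="\<lambda>i. secant_interp N (u i)" and al="\<lambda>i. secant_icpt N (u i)"])
      show "secant_interp N (u i) t = secant_icpt N (u i) (grid_cell N t) + secant_slope N (u i) (grid_cell N t) * t" for i t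
        by (rule secant_interp_def)
      show "\<forall>a<k. x a = 0" if "\<forall>i<m. (\<Sum>a<k. w i a * x a) = 0" for x
        using that by (rule ker)
      show "0 < Determinant.det (gram_mat k m w l)" if "\<forall>i<m. 0 < l i" for l
        using that by (rule gram)
      show "strict_mono (secant_interp N (u i))" "0 < secant_slope N (u i) c" if "i < m" for i c
        using that by (rule strict_mono_secant_interp[OF mono] secant_slope_pos[OF mono])+
    qed (simp_all add: secant_interp_meas)
  qed
  also have "\<dots> = (\<integral>\<^sup>+z. G z \<partial>leb {..<k})" by (rule Liminf_const) simp
  finally show ?thesis .
qed

section \<open>Powers and Hoelder's inequality\<close>

lemma measurable_enn_powr [measurable]: "(\<lambda>x. enn_powr x a) \<in> borel_measurable borel"
  unfolding enn_powr_def by measurable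

lemma enn_powr_ennreal [simp]: "0 \<le> x \<Longrightarrow> enn_powr (ennreal x) a = ennreal (x powr a)"
  by (simp add: enn_powr_def)

lemma enn_powr_top [simp]: "enn_powr top_class.top a = top_class.top"
  by (simp add: enn_powr_def)

lemma enn_powr_mono:
  assumes "x \<le> y" "0 \<le> a" shows "enn_powr x a \<le> enn_powr y a"
proof (cases "y = \<infinity>")
  case False
  then have "enn2real x \<le> enn2real y" using assms(1)
    by (intro enn2real_mono) (auto simp: less_top)
  moreover have "x \<noteq> \<infinity>" using False assms(1) by (auto simp: top_unique)
  ultimately show ?thesis using False assms(2)
    by (auto simp: enn_powr_def intro!: ennreal_leI powr_mono2)
qed simp

lemma enn_powr_cmult:
  assumes c: "0 < c" shows "enn_powr (ennreal c * x) a = ennreal (c powr a) * enn_powr x a"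
proof (cases x)
  case (real y)
  then show ?thesis using c by (simp add: ennreal_mult[symmetric] powr_mult)
next
  case top
  have "ennreal c * \<infinity> = \<infinity>" "ennreal (c powr a) * \<infinity> = \<infinity>" using c by (simp_all add: ennreal_mult_top)
  then show ?thesis using top by simp
qed

lemma enn_powr_eq_0_iff: "0 < a \<Longrightarrow> enn_powr x a = 0 \<longleftrightarrow> x = 0"
  by (cases x) (auto simp: ennreal_eq_0_iff)

text \<open>Young's inequality for the functions divided by their norms. Norms equal to 0 or
  \<infinity> cannot be divided out and are treated separately.\<close>

lemma nn_integral_Holder:
  fixes f g :: "'a \<Rightarrow> real"
  assumes [measurable]: "f \<in> borel_measurable M" "g \<in> borel_measurable M"
    and nonneg: "\<And>x. 0 \<le> f x" "\<And>x. 0 \<le> g x"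
    and rs: "1 < r" "1 < s" "1 / r + 1 / s = 1"
  shows "(\<integral>\<^sup>+x. ennreal (f x * g x) \<partial>M) \<le>
    enn_powr (\<integral>\<^sup>+x. ennreal (f x powr r) \<partial>M) (1 / r) * enn_powr (\<integral>\<^sup>+x. ennreal (g x powr s) \<partial>M) (1 / s)"
    (is "?L \<le> enn_powr ?A _ * enn_powr ?B _")
proof -
  consider "?A = 0 \<or> ?B = 0" | "?A \<noteq> 0" "?B \<noteq> 0" "?A = \<infinity> \<or> ?B = \<infinity>"
    | "?A \<noteq> 0" "?B \<noteq> 0" "?A \<noteq> \<infinity>" "?B \<noteq> \<infinity>" by blast
  then show ?thesis
  proof cases
    case 1
    \<comment> \<open>The right side may be the product of 0 and \<infinity>, which is 0 in
      \<open>ennreal\<close>; hence the left side has to vanish.\<close>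
    have "AE x in M. f x * g x = 0"
      using 1
    proof
      assume "?A = 0"
      then have "AE x in M. ennreal (f x powr r) = 0" by (subst (asm) nn_integral_0_iff_AE) auto
      then show ?thesis by eventually_elim (simp add: ennreal_eq_0_iff)
    next
      assume "?B = 0"
      then have "AE x in M. ennreal (g x powr s) = 0" by (subst (asm) nn_integral_0_iff_AE) auto
      then show ?thesis by eventually_elim (simp add: ennreal_eq_0_iff)
    qed
    then have "?L = (\<integral>\<^sup>+x. 0 \<partial>M)" by (intro nn_integral_cong_AE) auto
    then show ?thesis by simp
  next
    case 2
    have "enn_powr ?A (1 / r) \<noteq> 0" "enn_powr ?B (1 / s) \<noteq> 0"
      using 2 rs by (simp_all add: enn_powr_eq_0_iff)
    moreover have "enn_powr ?A (1 / r) = \<infinity> \<or> enn_powr ?B (1 / s) = \<infinity>"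
      using 2 by auto
    ultimately have "enn_powr ?A (1 / r) * enn_powr ?B (1 / s) = \<infinity>"
      by (auto simp: ennreal_mult_eq_top_iff)
    then show ?thesis by simp
  next
    case 3
    define a where "a = enn2real ?A"
    define b where "b = enn2real ?B"
    have A: "?A = ennreal a" and B: "?B = ennreal b" using 3 by (simp_all add: a_def b_def less_top)
    have a: "0 < a" and b: "0 < b"
      using 3 by (simp_all add: a_def b_def enn2real_positive_iff less_top zero_less_iff_neq_zero)
    define \<alpha> where "\<alpha> = a powr (1 / r)"
    define \<beta> where "\<beta> = b powr (1 / s)"
    \<comment> \<open>The coefficients that Young's inequality leaves after multiplication by
      \<open>\<alpha> * \<beta>\<close>; integrated against \<open>a\<close> and \<open>b\<close>
      they give \<open>\<alpha> * \<beta> * (1 / r + 1 / s)\<close>.\<close>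
    define C1 where "C1 = \<alpha> * \<beta> * (1 / r / a)"
    define C2 where "C2 = \<alpha> * \<beta> * (1 / s / b)"
    have C: "0 \<le> C1" "0 \<le> C2"
      using rs a b by (simp_all add: C1_def C2_def \<alpha>_def \<beta>_def)
    have pt: "f x * g x \<le> C1 * f x powr r + C2 * g x powr s" for x
    proof -
      have "f x / \<alpha> * (g x / \<beta>) \<le> (f x / \<alpha>) powr r / r + (g x / \<beta>) powr s / s"
        using rs nonneg by (intro Youngs_inequality) (auto simp: \<alpha>_def \<beta>_def)
      also have "(f x / \<alpha>) powr r = f x powr r / a"
        using rs a nonneg by (simp add: powr_divide powr_powr \<alpha>_def)
      also have "(g x / \<beta>) powr s = g x powr s / b"
        using rs b nonneg by (simp add: powr_divide powr_powr \<beta>_def)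
      finally have "f x / \<alpha> * (g x / \<beta>) \<le> f x powr r / a / r + g x powr s / b / s" .
      then have "\<alpha> * \<beta> * (f x / \<alpha> * (g x / \<beta>)) \<le> \<alpha> * \<beta> * (f x powr r / a / r + g x powr s / b / s)"
        by (rule mult_left_mono) (simp add: \<alpha>_def \<beta>_def)
      moreover have "\<alpha> * \<beta> * (f x / \<alpha> * (g x / \<beta>)) = f x * g x"
        using a b by (simp add: \<alpha>_def \<beta>_def)
      ultimately show ?thesis by (simp add: C1_def C2_def algebra_simps)
    qed
    have "?L \<le> (\<integral>\<^sup>+x. ennreal (C1) * ennreal (f x powr r)
        + ennreal (C2) * ennreal (g x powr s) \<partial>M)"
    proof (rule nn_integral_mono)
      fix x
      have "ennreal (C1) * ennreal (f x powr r)
        + ennreal (C2) * ennreal (g x powr s)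
        = ennreal (C1 * f x powr r + C2 * g x powr s)"
        using C by (simp add: ennreal_mult[symmetric] ennreal_plus[symmetric] del: ennreal_plus)
      then show "ennreal (f x * g x) \<le> ennreal (C1) * ennreal (f x powr r)
        + ennreal (C2) * ennreal (g x powr s)"
        using pt[of x] by (simp add: ennreal_leI)
    qed
    also have "\<dots> = ennreal (C1) * ?A + ennreal (C2) * ?B"
      by (simp add: nn_integral_add nn_integral_cmult)
    also have "\<dots> = ennreal (C1 * a + C2 * b)"
      unfolding A B using C a b
      by (simp add: ennreal_mult[symmetric] ennreal_plus[symmetric] del: ennreal_plus)
    also have "C1 * a + C2 * b = \<alpha> * \<beta> * (1 / r + 1 / s)"
      using a b by (simp add: C1_def C2_def distrib_left)
    also have "\<dots> = \<alpha> * \<beta>" using rs by simp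
    also have "ennreal (\<alpha> * \<beta>) = enn_powr ?A (1 / r) * enn_powr ?B (1 / s)"
      unfolding A B using a b by (simp add: \<alpha>_def \<beta>_def ennreal_mult)
    finally show ?thesis .
  qed
qed

section \<open>The transport argument\<close>

locale orthogonal_split =
  fixes m n :: nat and V :: "real Matrix.mat"
  assumes nm: "n \<le> m"
    and V: "V \<in> carrier_mat m m" "V * transpose_mat V = 1\<^sub>m m"
begin

definition rot :: "(nat \<Rightarrow> real) \<Rightarrow> (nat \<Rightarrow> real) \<Rightarrow> nat \<Rightarrow> real" where
  "rot x y = (\<lambda>i\<in>{..<m}. ip_row m V i (glue n x y))"

text \<open>The last \<open>m - n\<close> coordinates of \<open>V\<^sup>T t\<close>.\<close>

definition unrot :: "(nat \<Rightarrow> real) \<Rightarrow> nat \<Rightarrow> real" where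
  "unrot t = (\<lambda>a\<in>{n..<m}. \<Sum>i<m. t i * V $$ (i, a))"

lemma Vt: "transpose_mat V \<in> carrier_mat m m" "transpose_mat V * V = 1\<^sub>m m"
  using V mat_mult_left_right_inverse[of V m "transpose_mat V"] by auto

lemma columns_orthonormal:
  assumes "a < m" "b < m"
  shows "(\<Sum>i<m. V $$ (i, a) * V $$ (i, b)) = (if a = b then 1 else 0)"
proof -
  have "(\<Sum>i<m. V $$ (i, a) * V $$ (i, b)) = (transpose_mat V * V) $$ (a, b)"
    using assms V by (simp add: scalar_prod_def atLeast0LessThan)
  then show ?thesis using assms by (simp add: Vt(2))
qed

lemma split_index: "{..<n} \<union> {n..<m} = {..<m}"
  using nm by auto

text \<open>\<open>merge\<close> is the gluing for which product integrals split. It differs from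
  \<open>glue\<close> only at indices from \<open>m\<close> on, which \<open>V\<close> never
  reads.\<close>

lemma rot_eq: "rot x y = mat_app V (merge {..<n} {n..<m} (x, y))"
proof -
  have "(\<Sum>j<m. glue n x y j * V $$ (i, j)) = (\<Sum>j<m. V $$ (i, j) * merge {..<n} {n..<m} (x, y) j)" for i
    by (intro sum.cong) (auto simp: glue_def merge_def)
  then show ?thesis using V by (auto simp: rot_def mat_app_def ip_row_def)
qed

lemma measurable_rot:
  "(\<lambda>p. rot (fst p) (snd p)) \<in> leb {..<n} \<Otimes>\<^sub>M leb {n..<m} \<rightarrow>\<^sub>M leb {..<m}"
  using measurable_compose[OF measurable_merge[of "{..<n}" "{n..<m}" "\<lambda>_. lborel :: real measure", unfolded split_index] measurable_mat_app[OF V(1)]]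
  by (simp add: rot_eq)

lemma measurable_rot1:
  assumes "y \<in> space (leb {n..<m})"
  shows "(\<lambda>x. rot x y) \<in> leb {..<n} \<rightarrow>\<^sub>M leb {..<m}"
  using measurable_compose[OF measurable_Pair2'[OF assms] measurable_rot] by simp

lemma measurable_rot2:
  assumes "x \<in> space (leb {..<n})"
  shows "rot x \<in> leb {n..<m} \<rightarrow>\<^sub>M leb {..<m}"
  using measurable_compose[OF measurable_Pair1'[OF assms] measurable_rot] assms by simp

lemma measurable_unrot [measurable]: "unrot \<in> leb {..<m} \<rightarrow>\<^sub>M leb {n..<m}"
  unfolding unrot_def[abs_def] by measurable

text \<open>By orthogonality the transpose of \<open>V\<close> recovers the glued vector. This turns
  a function of \<open>y\<close> alone into a function of the rotated vector.\<close>

lemma unrot_rot: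
  assumes "y \<in> space (leb {n..<m})"
  shows "unrot (rot x y) = y"
proof
  fix a
  define z where "z = (\<lambda>i\<in>{..<m}. merge {..<n} {n..<m} (x, y) i)"
  have rot_z: "rot x y = mat_app V z"
    using V unfolding rot_eq by (auto simp: mat_app_def z_def)
  have "unrot (rot x y) a = mat_app (transpose_mat V) (mat_app V z) a" if "a \<in> {n..<m}"
    using that V unfolding rot_z by (auto simp: unrot_def mat_app_def[of "transpose_mat V"] mult.commute intro!: sum.cong)
  also have "mat_app (transpose_mat V) (mat_app V z) = z"
    unfolding mat_app_mult[OF Vt(1) V(1), symmetric] Vt(2)
    by (rule mat_app_one) (simp add: z_def space_PiM)
  finally show "unrot (rot x y) a = y a"
    using assms by (cases "a \<in> {n..<m}") (auto simp: z_def merge_def unrot_def space_PiM PiE_def extensional_def)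
qed

lemma nn_integral_orthogonal:
  assumes g: "g \<in> borel_measurable (leb {..<m})"
  shows "(\<integral>\<^sup>+z. g (mat_app V z) \<partial>leb {..<m}) = (\<integral>\<^sup>+z. g z \<partial>leb {..<m})"
proof -
  have "Determinant.det V * Determinant.det V = 1"
    using Determinant.det_mult[OF V(1) Vt(1)] V by (simp add: Determinant.det_transpose[OF V(1)])
  then have "\<bar>Determinant.det V\<bar> = 1" "Determinant.det V \<noteq> 0"
    by (auto simp: square_eq_1_iff)
  then show ?thesis
    using scales_leb_invertible[OF V(1)] g by (simp add: scales_leb_def)
qed

text \<open>The rotation preserves Lebesgue measure, so either group of coordinates may be
  integrated first. The second order is the one on the left of the theorem, the first the one on the
  right.\<close>

lemma nn_integral_rot:
  assumes g[measurable]: "g \<in> borel_measurable (leb {..<m})"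
  shows "(\<integral>\<^sup>+x. \<integral>\<^sup>+y. g (rot x y) \<partial>leb {n..<m} \<partial>leb {..<n}) = (\<integral>\<^sup>+t. g t \<partial>leb {..<m})"
    and "(\<integral>\<^sup>+y. \<integral>\<^sup>+x. g (rot x y) \<partial>leb {..<n} \<partial>leb {n..<m}) = (\<integral>\<^sup>+t. g t \<partial>leb {..<m})"
proof -
  have gV: "(\<lambda>z. g (mat_app V z)) \<in> borel_measurable (leb {..<m})"
    by (rule measurable_compose[OF measurable_mat_app[OF V(1)] g])
  have disj: "{n..<m} \<inter> {..<n} = {}" and disj': "{..<n} \<inter> {n..<m} = {}" by auto
  show "(\<integral>\<^sup>+x. \<integral>\<^sup>+y. g (rot x y) \<partial>leb {n..<m} \<partial>leb {..<n}) = (\<integral>\<^sup>+t. g t \<partial>leb {..<m})"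
    unfolding rot_eq nn_integral_orthogonal[OF g, symmetric]
    using leb.product_nn_integral_fold[of "{..<n}" "{n..<m}", unfolded split_index, OF disj' _ _ gV]
    by auto
  show "(\<integral>\<^sup>+y. \<integral>\<^sup>+x. g (rot x y) \<partial>leb {..<n} \<partial>leb {n..<m}) = (\<integral>\<^sup>+t. g t \<partial>leb {..<m})"
    unfolding rot_eq nn_integral_orthogonal[OF g, symmetric] merge_commute[OF disj, symmetric]
    using leb.product_nn_integral_fold[of "{n..<m}" "{..<n}", unfolded Un_commute[of "{n..<m}"] split_index, OF disj _ _ gV]
    by auto
qed

text \<open>With \<open>h y\<close> written as \<open>h (unrot t)\<close>, the left side is a single
  integral over R^m in \<open>t\<close>. The substitution acts on each \<open>t i\<close>
  separately, and splitting the result the other way round leaves the first coordinates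
  outside.\<close>

lemma nn_integral_transport:
  fixes u u' :: "nat \<Rightarrow> real \<Rightarrow> real"
  assumes u: "\<And>i. i < m \<Longrightarrow> strict_mono (u i)" "\<And>i. i < m \<Longrightarrow> surj (u i)"
      "\<And>i t. i < m \<Longrightarrow> (u i has_real_derivative u' i t) (at t)"
    and u': "\<And>i. i < m \<Longrightarrow> u' i \<in> borel_measurable borel" "\<And>i t. i < m \<Longrightarrow> 0 \<le> u' i t"
    and P[measurable]: "P \<in> borel_measurable (leb {..<m})"
    and h[measurable]: "h \<in> borel_measurable (leb {n..<m})"
  shows "(\<integral>\<^sup>+y. (\<integral>\<^sup>+x. P (rot x y) \<partial>leb {..<n}) * h y \<partial>leb {n..<m}) =
    (\<integral>\<^sup>+x. \<integral>\<^sup>+y. (\<Prod>i<m. ennreal (u' i (rot x y i))) * (P (\<lambda>i\<in>{..<m}. u i (rot x y i)) *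
        h (unrot (\<lambda>i\<in>{..<m}. u i (rot x y i)))) \<partial>leb {n..<m} \<partial>leb {..<n})"
proof -
  have u_meas[measurable]: "u i \<in> borel_measurable borel" if "i < m" for i
    using DERIV_isCont[OF u(3)[OF that]] by (intro borel_measurable_continuous_onI) (simp add: continuous_on_eq_continuous_at)
  have [measurable]: "(\<lambda>t. ennreal (u' i t)) \<in> borel_measurable borel" if "i < m" for i
    using u'(1)[OF that] by measurable
  have um: "(\<lambda>t. \<lambda>i\<in>{..<m}. u i (t i)) \<in> leb {..<m} \<rightarrow>\<^sub>M leb {..<m}" by measurable
  have Ph[measurable]: "(\<lambda>t. P t * h (unrot t)) \<in> borel_measurable (leb {..<m})" by measurable
  have "(\<integral>\<^sup>+y. (\<integral>\<^sup>+x. P (rot x y) \<partial>leb {..<n}) * h y \<partial>leb {n..<m})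
    = (\<integral>\<^sup>+y. \<integral>\<^sup>+x. P (rot x y) * h (unrot (rot x y)) \<partial>leb {..<n} \<partial>leb {n..<m})"
    by (intro nn_integral_cong)
      (simp add: unrot_rot nn_integral_multc measurable_compose[OF measurable_rot1 P])
  also have "\<dots> = (\<integral>\<^sup>+t. P t * h (unrot t) \<partial>leb {..<m})"
    by (rule nn_integral_rot(2)[OF Ph])
  also have "\<dots> = (\<integral>\<^sup>+t. (\<Prod>i<m. ennreal (u' i (t i))) * (P (\<lambda>i\<in>{..<m}. u i (t i)) *
        h (unrot (\<lambda>i\<in>{..<m}. u i (t i)))) \<partial>leb {..<m})"
    by (rule nn_integral_leb_substitution[symmetric, OF _ _ _ _ Ph])
      (auto intro!: distr_density_monotone_surj u u')
  also have "\<dots> = (\<integral>\<^sup>+x. \<integral>\<^sup>+y. (\<Prod>i<m. ennreal (u' i (rot x y i))) * (P (\<lambda>i\<in>{..<m}. u i (rot x y i)) *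
        h (unrot (\<lambda>i\<in>{..<m}. u i (rot x y i)))) \<partial>leb {n..<m} \<partial>leb {..<n})"
    by (rule nn_integral_rot(1)[symmetric])
      (intro borel_measurable_times_ennreal measurable_compose[OF um Ph] borel_measurable_prod_ennreal, measurable)
  finally show ?thesis .
qed

lemma gram_det_eq: "gram_det m n V l = Determinant.det (gram_mat (m - n) m (\<lambda>i a. V $$ (i, n + a)) l)"
proof -
  have "Wmat m n V * diag_of m l * transpose_mat (Wmat m n V) = gram_mat (m - n) m (\<lambda>i a. V $$ (i, n + a)) l"
  proof (rule eq_matI)
    fix a b assume "a < dim_row (gram_mat (m - n) m (\<lambda>i a. V $$ (i, n + a)) l)"
      "b < dim_col (gram_mat (m - n) m (\<lambda>i a. V $$ (i, n + a)) l)"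
    then have ab: "a < m - n" "b < m - n" by (auto simp: gram_mat_def)
    have WD: "(Wmat m n V * diag_of m l) $$ (a, i) = V $$ (i, n + a) * l i" if "i < m" for i
    proof -
      have "(Wmat m n V * diag_of m l) $$ (a, i) = (\<Sum>j<m. V $$ (j, n + a) * (if j = i then l j else 0))"
        using that ab by (simp add: Wmat_def diag_of_def scalar_prod_def atLeast0LessThan)
      also have "\<dots> = (\<Sum>j<m. if j = i then V $$ (j, n + a) * l j else 0)"
        by (intro sum.cong) auto
      finally show ?thesis using that by simp
    qed
    have "(Wmat m n V * diag_of m l * transpose_mat (Wmat m n V)) $$ (a, b)
        = (\<Sum>i<m. (Wmat m n V * diag_of m l) $$ (a, i) * V $$ (i, n + b))"
      using ab by (simp add: scalar_prod_def atLeast0LessThan Wmat_def diag_of_def)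
    then show "(Wmat m n V * diag_of m l * transpose_mat (Wmat m n V)) $$ (a, b)
        = gram_mat (m - n) m (\<lambda>i a. V $$ (i, n + a)) l $$ (a, b)"
      using ab WD by (simp add: gram_mat_def ac_simps)
  qed (auto simp: Wmat_def gram_mat_def)
  then show ?thesis by (simp add: gram_det_def)
qed

lemma measurable_gram_det:
  assumes "\<And>i. i < m \<Longrightarrow> v i \<in> borel_measurable borel"
  shows "(\<lambda>t. gram_det m n V (\<lambda>i. v i (t i))) \<in> borel_measurable (leb {..<m})"
  unfolding gram_det_eq
proof (rule borel_measurable_det[where k="m - n"])
  have [measurable]: "(\<lambda>t. v i (t i)) \<in> borel_measurable (leb {..<m})" if "i < m" for i
    using that assms by (intro measurable_compose[OF measurable_component_singleton]) auto
  fix a b assume "a < m - n" "b < m - n"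
  then show "(\<lambda>t. gram_mat (m - n) m (\<lambda>i a. V $$ (i, n + a)) (\<lambda>i. v i (t i)) $$ (a, b)) \<in> borel_measurable (leb {..<m})"
    by (simp add: gram_mat_def)
qed (simp add: gram_mat_def)

text \<open>For frozen \<open>x\<close> the map from \<open>y\<close> to the last coordinates of the
  transported point is a ridge map: the first coordinates enter only through the offsets
  \<open>b i\<close>, and \<open>gram_det\<close> is its Jacobian.\<close>

lemma nn_integral_fiber_le:
  fixes u u' :: "nat \<Rightarrow> real \<Rightarrow> real"
  assumes u: "\<And>i. i < m \<Longrightarrow> strict_mono (u i)"
      "\<And>i t. i < m \<Longrightarrow> (u i has_real_derivative u' i t) (at t)"
      "\<And>i. i < m \<Longrightarrow> continuous_on UNIV (u' i)" "\<And>i t. i < m \<Longrightarrow> 0 < u' i t"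
    and gram: "\<And>l. (\<forall>i<m. 0 < l i) \<Longrightarrow> 0 < gram_det m n V l"
    and H[measurable]: "H \<in> borel_measurable (leb {n..<m})"
    and lsc: "\<And>z Z. (\<forall>N. Z N \<in> space (leb {n..<m})) \<Longrightarrow> z \<in> space (leb {n..<m}) \<Longrightarrow>
        (\<forall>a\<in>{n..<m}. (\<lambda>N. Z N a) \<longlonglongrightarrow> z a) \<Longrightarrow> H z \<le> liminf (\<lambda>N. H (Z N))"
    and x: "x \<in> space (leb {..<n})"
  shows "(\<integral>\<^sup>+y. ennreal (gram_det m n V (\<lambda>i. u' i (rot x y i))) *
      H (unrot (\<lambda>i\<in>{..<m}. u i (rot x y i))) \<partial>leb {n..<m}) \<le> (\<integral>\<^sup>+y. H y \<partial>leb {n..<m})"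
proof -
  define k where "k = m - n"
  define w where "w = (\<lambda>i a. V $$ (i, n + a))"
  define b where "b = (\<lambda>i. \<Sum>j<n. x j * V $$ (i, j))"
  define sh where "sh = (\<lambda>z::nat \<Rightarrow> real. \<lambda>i\<in>{n..<m}. z (i - n))"
  have sh_space: "sh z \<in> space (leb {n..<m})" for z by (auto simp: sh_def space_PiM)
  have sh[measurable]: "sh \<in> leb {..<k} \<rightarrow>\<^sub>M leb {n..<m}"
    unfolding sh_def k_def by (intro measurable_restrict measurable_component_singleton) auto
  have ridge: "rot x (sh z) i = ridge_arg k w b i z" if "i < m" for i z
  proof -
    have "ip_row m V i (glue n x (sh z)) = (\<Sum>j<n. glue n x (sh z) j * V $$ (i, j)) +
        (\<Sum>j\<in>{n..<m}. glue n x (sh z) j * V $$ (i, j))"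
      unfolding ip_row_def split_index[symmetric] by (rule sum.union_disjoint) auto
    also have "(\<Sum>j<n. glue n x (sh z) j * V $$ (i, j)) = b i"
      unfolding b_def by (intro sum.cong) (auto simp: glue_def)
    also have "(\<Sum>j\<in>{n..<m}. glue n x (sh z) j * V $$ (i, j)) = (\<Sum>a<k. w i a * z a)"
      by (rule sum.reindex_bij_witness[of _ "\<lambda>a. a + n" "\<lambda>j. j - n"])
        (auto simp: glue_def sh_def w_def k_def)
    finally show ?thesis using that by (simp add: rot_def ridge_arg_def)
  qed
  have unrot_ridge: "unrot (\<lambda>i\<in>{..<m}. u i (rot x (sh z) i)) = sh (ridge_map k m w b u z)" for z
  proof
    fix a
    have "(\<Sum>i<m. u i (rot x (sh z) i) * V $$ (i, a)) = (\<Sum>i<m. u i (ridge_arg k w b i z) * V $$ (i, a))"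
      by (intro sum.cong) (auto simp: ridge)
    then show "unrot (\<lambda>i\<in>{..<m}. u i (rot x (sh z) i)) a = sh (ridge_map k m w b u z) a"
      using fun_cong[OF fun_cong[OF sh_def], of "ridge_map k m w b u z" a]
      by (cases "a \<in> {n..<m}") (auto simp: unrot_def ridge_map_def k_def w_def)
  qed
  have u'_meas: "u' i \<in> borel_measurable borel" if "i < m" for i
    using u(3)[OF that] by (rule borel_measurable_continuous_onI)
  have u_meas[measurable]: "u i \<in> borel_measurable borel" if "i < m" for i
    using DERIV_isCont[OF u(2)[OF that]] by (intro borel_measurable_continuous_onI) (simp add: continuous_on_eq_continuous_at)
  have um: "(\<lambda>t. \<lambda>i\<in>{..<m}. u i (t i)) \<in> leb {..<m} \<rightarrow>\<^sub>M leb {..<m}" by measurable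
  have gm: "(\<lambda>t. gram_det m n V (\<lambda>i. u' i (t i))) \<in> borel_measurable (leb {..<m})"
    by (rule measurable_gram_det) (rule u'_meas)
  have \<Psi>: "(\<lambda>y. ennreal (gram_det m n V (\<lambda>i. u' i (rot x y i))) *
      H (unrot (\<lambda>i\<in>{..<m}. u i (rot x y i)))) \<in> borel_measurable (leb {n..<m})"
    by (intro borel_measurable_times_ennreal measurable_compose[OF _ measurable_ennreal]
        measurable_compose[OF measurable_rot2[OF x] gm]
        measurable_compose[OF measurable_rot2[OF x] measurable_compose[OF um measurable_compose[OF measurable_unrot H]]])
  have "(\<integral>\<^sup>+y. ennreal (gram_det m n V (\<lambda>i. u' i (rot x y i))) *
      H (unrot (\<lambda>i\<in>{..<m}. u i (rot x y i))) \<partial>leb {n..<m})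
    = (\<integral>\<^sup>+z. ennreal (gram_det m n V (\<lambda>i. u' i (rot x (sh z) i))) *
      H (unrot (\<lambda>i\<in>{..<m}. u i (rot x (sh z) i))) \<partial>leb {..<k})"
    unfolding sh_def k_def by (rule nn_integral_leb_shift[OF \<Psi>])
  also have "\<dots> = (\<integral>\<^sup>+z. ennreal (Determinant.det (gram_mat k m w (\<lambda>i. u' i (ridge_arg k w b i z)))) *
      H (sh (ridge_map k m w b u z)) \<partial>leb {..<k})"
  proof -
    have "gram_mat k m w (\<lambda>i. u' i (rot x (sh z) i)) = gram_mat k m w (\<lambda>i. u' i (ridge_arg k w b i z))" for z
      unfolding gram_mat_def by (rule eq_matI) (auto simp: ridge)
    then show ?thesis by (simp add: gram_det_eq unrot_ridge k_def[symmetric] w_def[symmetric])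
  qed
  also have "\<dots> \<le> (\<integral>\<^sup>+z. H (sh z) \<partial>leb {..<k})"
  proof (rule ridge_substitution_le[where G="\<lambda>z. H (sh z)"])
    show "0 < Determinant.det (gram_mat k m w l)" if "\<forall>i<m. 0 < l i" for l
      using gram[OF that] by (simp add: gram_det_eq k_def w_def)
    \<comment> \<open>The rows of M are columns of an orthogonal matrix, so M M^T = 1; applying M to
      M^T c = 0 gives c = 0.\<close>
    show "\<forall>a<k. c a = 0" if c: "\<forall>i<m. (\<Sum>a<k. w i a * c a) = 0" for c
    proof (intro allI impI)
      fix a assume a: "a < k"
      have "0 = (\<Sum>i<m. w i a * (\<Sum>a'<k. w i a' * c a'))" using c by simp
      also have "\<dots> = (\<Sum>a'<k. (\<Sum>i<m. w i a * w i a') * c a')"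
        unfolding sum_distrib_left sum_distrib_right mult.assoc by (rule sum.swap)
      also have "\<dots> = (\<Sum>a'<k. (if a' = a then c a' else 0))"
        using a by (intro sum.cong) (auto simp: w_def columns_orthonormal k_def)
      also have "\<dots> = c a" using a by simp
      finally show "c a = 0" by simp
    qed
    show "H (sh z) \<le> liminf (\<lambda>N. H (sh (Z N)))"
      if "\<forall>a<k. (\<lambda>N. Z N a) \<longlonglongrightarrow> z a" for z Z
      using that sh_space by (intro lsc) (auto simp: sh_def k_def)
  qed (use u in auto)
  also have "\<dots> = (\<integral>\<^sup>+y. H y \<partial>leb {n..<m})"
    unfolding sh_def k_def by (rule nn_integral_leb_shift[OF H, symmetric])
  finally show ?thesis .
qed

end

section \<open>Transport maps and the estimate against a test function\<close>

locale young_transport = orthogonal_split +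
  fixes r D :: real and p :: "nat \<Rightarrow> real" and f F u u' :: "nat \<Rightarrow> real \<Rightarrow> real"
  assumes r: "1 < r" and p: "\<And>i. i < m \<Longrightarrow> 1 < p i"
    and D: "0 < D" "det_ineq m n V r p D"
    and f: "\<And>i. i < m \<Longrightarrow> continuous_on UNIV (f i)" "\<And>i t. i < m \<Longrightarrow> 0 < f i t"
    and F: "\<And>i. i < m \<Longrightarrow> continuous_on UNIV (F i)" "\<And>i t. i < m \<Longrightarrow> 0 < F i t"
    and u: "\<And>i. i < m \<Longrightarrow> strict_mono (u i)" "\<And>i. i < m \<Longrightarrow> surj (u i)"
      "\<And>i t. i < m \<Longrightarrow> (u i has_real_derivative u' i t) (at t)"
      "\<And>i t. i < m \<Longrightarrow> u' i t = F i t / f i (u i t)"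
begin

definition "s = conj_exp r"

definition weight :: "(nat \<Rightarrow> real \<Rightarrow> real) \<Rightarrow> (nat \<Rightarrow> real) \<Rightarrow> real" where
  "weight g t = (\<Prod>i<m. g i (t i) powr (1 / p i))"

definition rhs :: ennreal where
  "rhs = (\<integral>\<^sup>+x. enn_powr (\<integral>\<^sup>+y. ennreal (weight F (rot x y) powr r) \<partial>leb {n..<m}) (1 / r) \<partial>leb {..<n})"

definition marginal :: "(nat \<Rightarrow> real) \<Rightarrow> ennreal" where
  "marginal y = (\<integral>\<^sup>+x. ennreal (weight f (rot x y)) \<partial>leb {..<n})"

lemma s: "1 < s" "1 / r + 1 / s = 1" "(r - 1) * s = r"
  using r by (simp_all add: s_def conj_exp_def field_simps)

lemma weight_nonneg: "0 \<le> weight g t"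
  unfolding weight_def by (intro prod_nonneg) simp

lemma measurable_weight:
  assumes "\<And>i. i < m \<Longrightarrow> continuous_on UNIV (g i)"
  shows "weight g \<in> borel_measurable (leb {..<m})"
proof -
  have [measurable]: "g i \<in> borel_measurable borel" if "i < m" for i
    using assms[OF that] by (rule borel_measurable_continuous_onI)
  show ?thesis unfolding weight_def[abs_def] by measurable
qed

lemma u_cont: "i < m \<Longrightarrow> continuous_on UNIV (u i)"
  using DERIV_isCont[OF u(3)] by (simp add: continuous_on_eq_continuous_at)

lemma u'_pos: "i < m \<Longrightarrow> 0 < u' i t"
  by (simp add: u(4) f F)

lemma u'_cont: "i < m \<Longrightarrow> continuous_on UNIV (u' i)"
proof -
  assume i: "i < m"
  have "continuous_on UNIV (\<lambda>t. F i t / f i (u i t))"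
  proof (intro continuous_on_divide F(1)[OF i] ballI)
    show "continuous_on UNIV (\<lambda>t. f i (u i t))"
      using continuous_on_compose2[OF f(1)[OF i] u_cont[OF i]] by simp
    show "f i (u i t) \<noteq> 0" for t using f(2)[OF i, of "u i t"] by simp
  qed
  moreover have "u' i = (\<lambda>t. F i t / f i (u i t))" by (rule ext) (rule u(4)[OF i])
  ultimately show ?thesis by simp
qed

text \<open>One factor of \<open>u' i\<close> is split by the exponents 1/p_i and 1/p_i'. The first
  share combines with \<open>f i\<close> into a power of \<open>F i\<close>, since F_i = u_i'
  f_i(u_i); the second is the surplus on the right.\<close>

lemma weight_transport:
  "(\<Prod>i<m. u' i (t i)) * weight f (\<lambda>i\<in>{..<m}. u i (t i)) =
    weight F t * (\<Prod>i<m. u' i (t i) powr (1 / conj_exp (p i)))"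
  unfolding weight_def prod.distrib[symmetric]
proof (rule prod.cong)
  fix i assume "i \<in> {..<m}"
  then have i: "i < m" by simp
  have e: "1 / conj_exp (p i) = 1 - 1 / p i"
    using p[OF i] by (simp add: conj_exp_def field_simps)
  have Fi: "F i (t i) = u' i (t i) * f i (u i (t i))"
    using f(2)[OF i, of "u i (t i)"] by (simp add: u(4)[OF i])
  have "F i (t i) powr (1 / p i) * u' i (t i) powr (1 / conj_exp (p i)) =
      (u' i (t i) powr (1 / p i) * u' i (t i) powr (1 - 1 / p i)) * f i (u i (t i)) powr (1 / p i)"
    unfolding Fi e using u'_pos[OF i, of "t i"] f(2)[OF i, of "u i (t i)"]
    by (simp add: powr_mult)
  also have "u' i (t i) powr (1 / p i) * u' i (t i) powr (1 - 1 / p i) = u' i (t i)"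
    using u'_pos[OF i, of "t i"] by (simp add: powr_add[symmetric])
  finally show "u' i (t i) * f i ((\<lambda>i\<in>{..<m}. u i (t i)) i) powr (1 / p i) =
      F i (t i) powr (1 / p i) * u' i (t i) powr (1 / conj_exp (p i))"
    using i by simp
qed simp

text \<open>A positive \<open>D\<close> bounds the determinant below by a positive product, so the
  affine pieces of the fibre map are invertible.\<close>

lemma gram_pos: "(\<forall>i<m. 0 < l i) \<Longrightarrow> 0 < gram_det m n V l"
proof -
  assume l: "\<forall>i<m. 0 < l i"
  have "0 < D * (\<Prod>i<m. l i powr (conj_exp r / conj_exp (p i)))"
    using l D by (intro mult_pos_pos prod_pos) (auto simp: less_le)
  also have "\<dots> \<le> gram_det m n V l" using D(2) l by (simp add: det_ineq_def)
  finally show ?thesis .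
qed

text \<open>Raising the surplus to the power \<open>s\<close>, which is r', yields exactly the
  exponents of \<open>det_ineq\<close>; this is where the constant \<open>D\<close> enters the
  estimate.\<close>

lemma jacobian_bound:
  "(\<Prod>i<m. u' i (t i) powr (1 / conj_exp (p i))) powr s \<le> (1 / D) * gram_det m n V (\<lambda>i. u' i (t i))"
proof -
  have "(\<Prod>i<m. u' i (t i) powr (1 / conj_exp (p i))) powr s =
      (\<Prod>i<m. u' i (t i) powr (conj_exp r / conj_exp (p i)))"
    by (simp add: prod_powr_distrib powr_powr s_def)
  also have "\<dots> \<le> (1 / D) * gram_det m n V (\<lambda>i. u' i (t i))"
    using D(2)[unfolded det_ineq_def, rule_format, of "\<lambda>i. u' i (t i)"] D(1) u'_pos
    by (simp add: field_simps)
  finally show ?thesis .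
qed

text \<open>The dual form of the theorem: \<open>marginal\<close> is paired with a nonnegative
  \<open>h\<close> measured in the norm of exponent r'.\<close>

lemma dual_bound:
  assumes h[measurable]: "h \<in> borel_measurable (leb {n..<m})" and h0: "\<And>y. 0 \<le> h y"
    and lsc: "\<And>z Z. (\<forall>N. Z N \<in> space (leb {n..<m})) \<Longrightarrow> z \<in> space (leb {n..<m}) \<Longrightarrow>
        (\<forall>a\<in>{n..<m}. (\<lambda>N. Z N a) \<longlonglongrightarrow> z a) \<Longrightarrow>
        ennreal (h z powr s) \<le> liminf (\<lambda>N. ennreal (h (Z N) powr s))"
  shows "(\<integral>\<^sup>+y. marginal y * ennreal (h y) \<partial>leb {n..<m}) \<le>
    rhs * (ennreal (D powr (- 1 / s)) * enn_powr (\<integral>\<^sup>+y. ennreal (h y powr s) \<partial>leb {n..<m}) (1 / s))"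
proof -
  define U where "U = (\<lambda>t::nat \<Rightarrow> real. \<lambda>i\<in>{..<m}. u i (t i))"
  \<comment> \<open>What remains beside \<open>weight F\<close> after the substitution; it becomes
    the second factor in Hoelder's inequality.\<close>
  define g where "g = (\<lambda>t. (\<Prod>i<m. u' i (t i) powr (1 / conj_exp (p i))) * h (unrot (U t)))"
  define S where "S = (\<integral>\<^sup>+y. ennreal (h y powr s) \<partial>leb {n..<m})"
  define A where "A = (\<lambda>x. \<integral>\<^sup>+y. ennreal (weight F (rot x y) powr r) \<partial>leb {n..<m})"
  have rhs_A: "rhs = (\<integral>\<^sup>+x. enn_powr (A x) (1 / r) \<partial>leb {..<n})" by (simp add: rhs_def A_def)
  have wf[measurable]: "weight f \<in> borel_measurable (leb {..<m})" by (rule measurable_weight) (rule f)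
  have wF[measurable]: "weight F \<in> borel_measurable (leb {..<m})" by (rule measurable_weight) (rule F)
  have u_meas[measurable]: "u i \<in> borel_measurable borel" if "i < m" for i
    using u_cont[OF that] by (rule borel_measurable_continuous_onI)
  have u'_meas[measurable]: "u' i \<in> borel_measurable borel" if "i < m" for i
    using u'_cont[OF that] by (rule borel_measurable_continuous_onI)
  have U[measurable]: "U \<in> leb {..<m} \<rightarrow>\<^sub>M leb {..<m}" unfolding U_def by measurable
  have g[measurable]: "g \<in> borel_measurable (leb {..<m})"
    unfolding g_def by measurable
  have g0: "0 \<le> g t" for t unfolding g_def by (intro mult_nonneg_nonneg prod_nonneg h0) simp
  have "(\<integral>\<^sup>+y. marginal y * ennreal (h y) \<partial>leb {n..<m}) =
    (\<integral>\<^sup>+x. \<integral>\<^sup>+y. (\<Prod>i<m. ennreal (u' i (rot x y i))) * (ennreal (weight f (U (rot x y))) *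
        ennreal (h (unrot (U (rot x y))))) \<partial>leb {n..<m} \<partial>leb {..<n})"
    unfolding marginal_def U_def
    by (rule nn_integral_transport) (simp_all add: u(1-3) u'_meas u'_pos[THEN less_imp_le])
  also have "\<dots> = (\<integral>\<^sup>+x. \<integral>\<^sup>+y. ennreal (weight F (rot x y) * g (rot x y)) \<partial>leb {n..<m} \<partial>leb {..<n})"
  proof (intro nn_integral_cong)
    fix x y
    let ?t = "rot x y"
    have pos: "0 \<le> (\<Prod>i<m. u' i (?t i))" by (intro prod_nonneg) (simp add: u'_pos[THEN less_imp_le])
    have "(\<Prod>i<m. ennreal (u' i (?t i))) = ennreal (\<Prod>i<m. u' i (?t i))"
      by (rule prod_ennreal) (simp add: u'_pos[THEN less_imp_le])
    then have "(\<Prod>i<m. ennreal (u' i (?t i))) * (ennreal (weight f (U ?t)) * ennreal (h (unrot (U ?t)))) =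
        ennreal ((\<Prod>i<m. u' i (?t i)) * weight f (U ?t) * h (unrot (U ?t)))"
      using pos by (simp add: ennreal_mult weight_nonneg h0 mult.assoc)
    also have "\<dots> = ennreal (weight F ?t * g ?t)"
      by (simp add: U_def g_def weight_transport mult.assoc)
    finally show "(\<Prod>i<m. ennreal (u' i (?t i))) * (ennreal (weight f (U ?t)) * ennreal (h (unrot (U ?t)))) =
        ennreal (weight F ?t * g ?t)" .
  qed
  \<comment> \<open>Hoelder's inequality acts in \<open>y\<close> for each frozen \<open>x\<close>.
    The bound for the second factor does not depend on \<open>x\<close>, so it leaves the outer
    integral, and what stays inside is \<open>rhs\<close>.\<close>
  also have "\<dots> \<le> (\<integral>\<^sup>+x. enn_powr (A x) (1 / r) * (ennreal (D powr (- 1 / s)) * enn_powr S (1 / s)) \<partial>leb {..<n})"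
  proof (rule nn_integral_mono)
    fix x assume x: "x \<in> space (leb {..<n})"
    note rot_meas = measurable_rot2[OF x]
    have "(\<integral>\<^sup>+y. ennreal (weight F (rot x y) * g (rot x y)) \<partial>leb {n..<m}) \<le>
        enn_powr (A x) (1 / r) * enn_powr (\<integral>\<^sup>+y. ennreal (g (rot x y) powr s) \<partial>leb {n..<m}) (1 / s)"
      unfolding A_def using r s
      by (intro nn_integral_Holder measurable_compose[OF rot_meas wF] measurable_compose[OF rot_meas g])
        (auto simp: weight_nonneg g0)
    also have "enn_powr (\<integral>\<^sup>+y. ennreal (g (rot x y) powr s) \<partial>leb {n..<m}) (1 / s) \<le>
        enn_powr (ennreal (1 / D) * S) (1 / s)"
    proof (rule enn_powr_mono)
      have "(\<integral>\<^sup>+y. ennreal (g (rot x y) powr s) \<partial>leb {n..<m}) \<le>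
        (\<integral>\<^sup>+y. ennreal (1 / D) * (ennreal (gram_det m n V (\<lambda>i. u' i (rot x y i))) *
            ennreal (h (unrot (\<lambda>i\<in>{..<m}. u i (rot x y i))) powr s)) \<partial>leb {n..<m})"
      proof (rule nn_integral_mono)
        fix y
        let ?t = "rot x y"
        have gp: "0 \<le> gram_det m n V (\<lambda>i. u' i (?t i))"
          by (rule less_imp_le[OF gram_pos]) (simp add: u'_pos)
        have "g ?t powr s = (\<Prod>i<m. u' i (?t i) powr (1 / conj_exp (p i))) powr s * h (unrot (U ?t)) powr s"
          unfolding g_def by (rule powr_mult)
        also have "\<dots> \<le> (1 / D) * gram_det m n V (\<lambda>i. u' i (?t i)) * h (unrot (U ?t)) powr s"
          by (intro mult_right_mono jacobian_bound) simp
        finally have "ennreal (g ?t powr s) \<le> ennreal ((1 / D) * gram_det m n V (\<lambda>i. u' i (?t i)) * h (unrot (U ?t)) powr s)"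
          by (rule ennreal_leI)
        also have "\<dots> = ennreal (1 / D) * (ennreal (gram_det m n V (\<lambda>i. u' i (?t i))) * ennreal (h (unrot (U ?t)) powr s))"
          using D(1) gp by (subst ennreal_mult, simp, simp, subst ennreal_mult) (auto simp: mult.assoc)
        finally show "ennreal (g ?t powr s) \<le> ennreal (1 / D) * (ennreal (gram_det m n V (\<lambda>i. u' i (?t i))) *
            ennreal (h (unrot (\<lambda>i\<in>{..<m}. u i (?t i))) powr s))"
          by (simp add: U_def)
      qed
      also have "\<dots> = ennreal (1 / D) * (\<integral>\<^sup>+y. ennreal (gram_det m n V (\<lambda>i. u' i (rot x y i))) *
            ennreal (h (unrot (\<lambda>i\<in>{..<m}. u i (rot x y i))) powr s) \<partial>leb {n..<m})"
      proof (rule nn_integral_cmult)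
        have "(\<lambda>t. gram_det m n V (\<lambda>i. u' i (t i))) \<in> borel_measurable (leb {..<m})"
          by (rule measurable_gram_det) (rule u'_meas)
        then have "(\<lambda>t. ennreal (gram_det m n V (\<lambda>i. u' i (t i))) * ennreal (h (unrot (U t)) powr s)) \<in> borel_measurable (leb {..<m})"
          by measurable
        from measurable_compose[OF rot_meas this]
        show "(\<lambda>y. ennreal (gram_det m n V (\<lambda>i. u' i (rot x y i))) *
            ennreal (h (unrot (\<lambda>i\<in>{..<m}. u i (rot x y i))) powr s)) \<in> borel_measurable (leb {n..<m})"
          unfolding U_def .
      qed
      also have "\<dots> \<le> ennreal (1 / D) * S"
        unfolding S_def
      proof (intro mult_left_mono nn_integral_fiber_le[where H="\<lambda>y. ennreal (h y powr s)"])
        show "0 < gram_det m n V l" if "\<forall>i<m. 0 < l i" for l using that by (rule gram_pos)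
        show "ennreal (h z powr s) \<le> liminf (\<lambda>N. ennreal (h (Z N) powr s))"
          if "\<forall>N. Z N \<in> space (leb {n..<m})" "z \<in> space (leb {n..<m})"
            "\<forall>a\<in>{n..<m}. (\<lambda>N. Z N a) \<longlonglongrightarrow> z a" for z Z
          using that by (rule lsc)
        show "(\<lambda>y. ennreal (h y powr s)) \<in> borel_measurable (leb {n..<m})" by measurable
      qed (simp_all add: x u(1-3) u'_cont u'_pos)
      finally show "(\<integral>\<^sup>+y. ennreal (g (rot x y) powr s) \<partial>leb {n..<m}) \<le> ennreal (1 / D) * S" .
    qed (use s in simp)
    also have "enn_powr (ennreal (1 / D) * S) (1 / s) = ennreal (D powr (- 1 / s)) * enn_powr S (1 / s)"
      using D(1) by (subst enn_powr_cmult) (simp_all add: powr_divide powr_minus_divide)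
    finally show "(\<integral>\<^sup>+y. ennreal (weight F (rot x y) * g (rot x y)) \<partial>leb {n..<m}) \<le>
        enn_powr (A x) (1 / r) * (ennreal (D powr (- 1 / s)) * enn_powr S (1 / s))"
      by (simp add: mult_left_mono)
  qed
  also have "\<dots> = rhs * (ennreal (D powr (- 1 / s)) * enn_powr S (1 / s))"
    unfolding rhs_A
  proof (rule nn_integral_multc)
    interpret sigma_finite_measure "leb {n..<m}" by (rule leb.sigma_finite) simp
    have "(\<lambda>t. ennreal (weight F t powr r)) \<in> borel_measurable (leb {..<m})" by measurable
    from measurable_compose[OF measurable_rot this]
    have "A \<in> borel_measurable (leb {..<n})"
      unfolding A_def[abs_def] by (intro borel_measurable_nn_integral) (simp add: split_beta')
    then show "(\<lambda>x. enn_powr (A x) (1 / r)) \<in> borel_measurable (leb {..<n})" by measurable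
  qed
  finally show ?thesis by (simp add: S_def)
qed

section \<open>Lower semicontinuity and truncation of the marginal\<close>

lemma measurable_weight_rot:
  "(\<lambda>q. ennreal (weight f (rot (fst q) (snd q)))) \<in> borel_measurable (leb {..<n} \<Otimes>\<^sub>M leb {n..<m})"
  using measurable_compose[OF measurable_rot measurable_compose[OF measurable_weight[OF f(1)] measurable_ennreal]] .

lemma measurable_marginal [measurable]: "marginal \<in> borel_measurable (leb {n..<m})"
proof -
  interpret sigma_finite_measure "leb {..<n}" by (rule leb.sigma_finite) simp
  have "(\<lambda>q. ennreal (weight f (rot (snd q) (fst q)))) \<in> borel_measurable (leb {n..<m} \<Otimes>\<^sub>M leb {..<n})"
    using measurable_compose[OF measurable_pair_swap' measurable_weight_rot] by (simp add: split_beta')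
  then show ?thesis
    unfolding marginal_def[abs_def] by (intro borel_measurable_nn_integral) (simp add: split_beta')
qed

text \<open>The integrand is continuous in the last coordinates for each fixed \<open>x\<close>, so
  Fatou's lemma in \<open>x\<close> gives the inequality without any domination.\<close>

lemma marginal_lsc:
  assumes Z: "\<And>N. Z N \<in> space (leb {n..<m})"
    and lim: "\<And>a. a \<in> {n..<m} \<Longrightarrow> (\<lambda>N. Z N a) \<longlonglongrightarrow> z a"
  shows "marginal z \<le> liminf (\<lambda>N. marginal (Z N))"
proof -
  have "marginal z = (\<integral>\<^sup>+x. liminf (\<lambda>N. ennreal (weight f (rot x (Z N)))) \<partial>leb {..<n})"
    unfolding marginal_def
  proof (rule nn_integral_cong)
    fix x
    have arg: "(\<lambda>N. rot x (Z N) i) \<longlonglongrightarrow> rot x z i" if "i < m" for i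
    proof -
      have "(\<lambda>N. glue n x (Z N) j) \<longlonglongrightarrow> glue n x z j" if "j < m" for j
        using lim[of j] that by (cases "j < n") (simp_all add: glue_def)
      then have "(\<lambda>N. ip_row m V i (glue n x (Z N))) \<longlonglongrightarrow> ip_row m V i (glue n x z)"
        unfolding ip_row_def by (intro tendsto_sum tendsto_mult tendsto_const) auto
      then show ?thesis using that by (simp add: rot_def)
    qed
    have "(\<lambda>N. weight f (rot x (Z N))) \<longlonglongrightarrow> weight f (rot x z)"
      unfolding weight_def
    proof (intro tendsto_prod tendsto_powr tendsto_const)
      fix i assume "i \<in> {..<m}"
      then have i: "i < m" by simp
      have "isCont (f i) (rot x z i)" using f(1)[OF i] by (simp add: continuous_on_eq_continuous_at)
      then show "(\<lambda>N. f i (rot x (Z N) i)) \<longlonglongrightarrow> f i (rot x z i)"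
        by (rule isCont_tendsto_compose) (rule arg[OF i])
      show "f i (rot x z i) \<noteq> 0" using f(2)[OF i, of "rot x z i"] by simp
    qed
    then show "ennreal (weight f (rot x z)) = liminf (\<lambda>N. ennreal (weight f (rot x (Z N))))"
      by (intro lim_imp_Liminf[symmetric] tendsto_ennrealI) auto
  qed
  also have "\<dots> \<le> liminf (\<lambda>N. marginal (Z N))"
    unfolding marginal_def
    by (rule nn_integral_liminf)
      (rule measurable_compose[OF measurable_rot1[OF Z] measurable_compose[OF measurable_weight[OF f(1)] measurable_ennreal]])
  finally show ?thesis .
qed

text \<open>
  Cutting off on an open box keeps the truncation lower semicontinuous, as \<open>dual_bound\<close> requires.
\<close>

definition trunc :: "nat \<Rightarrow> (nat \<Rightarrow> real) \<Rightarrow> real" where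
  "trunc N y = (if \<forall>a\<in>{n..<m}. \<bar>y a\<bar> < real N then enn2real (min (marginal y) (ennreal (real N))) else 0)"

lemma trunc_nonneg: "0 \<le> trunc N y"
  by (simp add: trunc_def)

lemma trunc_le: "ennreal (trunc N y) \<le> marginal y" "trunc N y \<le> real N"
proof -
  have "ennreal (enn2real (min (marginal y) (ennreal (real N)))) = min (marginal y) (ennreal (real N))"
    by (intro ennreal_enn2real) (simp add: min_less_iff_disj)
  then show "ennreal (trunc N y) \<le> marginal y"
    by (simp add: trunc_def)
  show "trunc N y \<le> real N"
    by (simp add: trunc_def enn2real_leI)
qed

lemma measurable_trunc [measurable]: "trunc N \<in> borel_measurable (leb {n..<m})"
  unfolding trunc_def[abs_def] by measurable

lemma trunc_greater:
  assumes "0 \<le> c" "\<forall>a\<in>{n..<m}. \<bar>y a\<bar> < real N"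
  shows "c < trunc N y \<longleftrightarrow> ennreal c < marginal y \<and> c < real N"
proof -
  have "c < trunc N y \<longleftrightarrow> ennreal c < ennreal (trunc N y)"
    using assms by (simp add: ennreal_less_iff)
  also have "ennreal (trunc N y) = min (marginal y) (ennreal (real N))"
    using assms by (simp add: trunc_def min_less_iff_disj)
  finally show ?thesis using assms by (simp add: ennreal_less_iff)
qed

text \<open>A strict lower bound persists along the sequence: the box is open,
  \<open>marginal\<close> is lower semicontinuous, the cap is constant, and a positive power is
  increasing.\<close>

lemma trunc_lsc:
  assumes Z: "\<forall>N. Z N \<in> space (leb {n..<m})"
    and lim: "\<forall>a\<in>{n..<m}. (\<lambda>N. Z N a) \<longlonglongrightarrow> z a" and q: "0 < q"
  shows "ennreal (trunc k z powr q) \<le> liminf (\<lambda>N. ennreal (trunc k (Z N) powr q))"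
  unfolding le_Liminf_iff
proof (intro allI impI)
  fix c :: ennreal assume c: "c < ennreal (trunc k z powr q)"
  then obtain c' where c': "c = ennreal c'" "0 \<le> c'" by (cases c) auto
  with c have lt: "c' < trunc k z powr q" by (simp add: ennreal_less_iff)
  define d where "d = c' powr (1 / q)"
  have d: "0 \<le> d" "c' = d powr q" using c' q by (simp_all add: d_def powr_powr)
  have iff: "d powr q < t powr q \<longleftrightarrow> d < t" if "0 \<le> t" for t
    using q d(1) that by (meson linorder_not_less powr_less_mono2 powr_mono2 less_imp_le)
  have dz: "d < trunc k z" using lt iff[OF trunc_nonneg] d by simp
  \<comment> \<open>Outside the box the truncation is 0, so exceeding the nonnegative
    \<open>d\<close> forces \<open>z\<close> into the box.\<close>
  then have box: "\<forall>a\<in>{n..<m}. \<bar>z a\<bar> < real k"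
    using d(1) by (auto simp: trunc_def split: if_splits)
  with dz have dz': "ennreal d < marginal z" "d < real k" using trunc_greater[OF d(1) box] by auto
  have "\<forall>\<^sub>F N in sequentially. \<forall>a\<in>{n..<m}. \<bar>Z N a\<bar> < real k"
    using lim box by (intro eventually_ball_finite ballI order_tendstoD(2)[OF tendsto_rabs]) auto
  moreover have "ennreal d < liminf (\<lambda>N. marginal (Z N))"
    using dz'(1) marginal_lsc[of Z z] Z lim by (auto intro: less_le_trans)
  then have "\<forall>\<^sub>F N in sequentially. ennreal d < marginal (Z N)" by (rule less_LiminfD)
  ultimately show "\<forall>\<^sub>F N in sequentially. c < ennreal (trunc k (Z N) powr q)"
  proof eventually_elim
    case (elim N)
    then have "d < trunc k (Z N)" using trunc_greater[OF d(1), of "Z N" k] dz'(2) by simp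
    then show ?case using iff[OF trunc_nonneg] c' d by (simp add: ennreal_less_iff)
  qed
qed

text \<open>The truncation is bounded by \<open>N\<close> and vanishes off a bounded box. Finiteness
  permits the division in \<open>trunc_norm_le\<close>.\<close>

lemma trunc_integral_finite: "(\<integral>\<^sup>+y. ennreal (trunc N y powr r) \<partial>leb {n..<m}) < top_class.top"
proof -
  let ?B = "Pi\<^sub>E {n..<m} (\<lambda>_. {- real N<..<real N})"
  have B: "?B \<in> sets (leb {n..<m})" by (intro sets_PiM_I_finite) auto
  have "(\<integral>\<^sup>+y. ennreal (trunc N y powr r) \<partial>leb {n..<m}) \<le>
      (\<integral>\<^sup>+y. ennreal (real N powr r) * indicator ?B y \<partial>leb {n..<m})"
  proof (rule nn_integral_mono)
    fix y assume y: "y \<in> space (leb {n..<m})"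
    show "ennreal (trunc N y powr r) \<le> ennreal (real N powr r) * indicator ?B y"
    proof (cases "y \<in> ?B")
      case True
      then show ?thesis using trunc_le(2)[of N y] trunc_nonneg[of N y] r
        by (simp add: ennreal_leI powr_mono2)
    next
      case False
      then have "trunc N y = 0" using y by (auto simp: trunc_def space_PiM PiE_iff abs_less_iff)
      then show ?thesis by simp
    qed
  qed
  also have "\<dots> = ennreal (real N powr r) * emeasure (leb {n..<m}) ?B"
    using B by (simp add: nn_integral_cmult)
  also have "emeasure (leb {n..<m}) ?B = ennreal ((2 * real N) ^ (m - n))"
    by (subst leb.emeasure_PiM) (auto simp: ennreal_power)
  also have "ennreal (real N powr r) * \<dots> < top_class.top"
    by (simp add: ennreal_mult[symmetric])
  finally show ?thesis .
qed

text \<open>The test function is the extremal one for Hoelder's inequality: since (r - 1) r' = r,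
  \<open>h powr s\<close> equals \<open>trunc N y powr r\<close>. The same integral \<sigma> thus
  stands on both sides, as \<open>\<sigma> \<le> c * \<sigma> powr (1 / s)\<close>, and cancelling
  leaves \<open>\<sigma> powr (1 / r) \<le> c\<close>.\<close>

lemma trunc_norm_le:
  assumes c: "0 \<le> c" "rhs * ennreal (D powr (- 1 / s)) = ennreal c"
  shows "(\<integral>\<^sup>+y. ennreal (trunc N y powr r) \<partial>leb {n..<m}) \<le> ennreal (c powr r)"
proof -
  define h where "h = (\<lambda>y. trunc N y powr (r - 1))"
  have hs: "h y powr s = trunc N y powr r" for y
    by (simp add: h_def powr_powr s(3))
  define S where "S = (\<integral>\<^sup>+y. ennreal (trunc N y powr r) \<partial>leb {n..<m})"
  obtain \<sigma> where \<sigma>: "S = ennreal \<sigma>" "0 \<le> \<sigma>"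
    using trunc_integral_finite[of N] by (cases S) (auto simp: S_def)
  have "S \<le> (\<integral>\<^sup>+y. marginal y * ennreal (h y) \<partial>leb {n..<m})"
    unfolding S_def
  proof (rule nn_integral_mono)
    fix y
    have "trunc N y powr r = trunc N y * trunc N y powr (r - 1)"
      using trunc_nonneg[of N y] by (cases "trunc N y = 0") (simp_all add: powr_mult_base)
    then have "ennreal (trunc N y powr r) = ennreal (trunc N y) * ennreal (h y)"
      using trunc_nonneg[of N y] by (simp add: h_def ennreal_mult)
    then show "ennreal (trunc N y powr r) \<le> marginal y * ennreal (h y)"
      by (simp add: mult_right_mono trunc_le)
  qed
  also have "\<dots> \<le> rhs * (ennreal (D powr (- 1 / s)) * enn_powr (\<integral>\<^sup>+y. ennreal (h y powr s) \<partial>leb {n..<m}) (1 / s))"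
  proof (rule dual_bound)
    show "h \<in> borel_measurable (leb {n..<m})" unfolding h_def by measurable
    show "0 \<le> h y" for y by (simp add: h_def)
    show "ennreal (h z powr s) \<le> liminf (\<lambda>N. ennreal (h (Z N) powr s))"
      if "\<forall>N. Z N \<in> space (leb {n..<m})" "\<forall>a\<in>{n..<m}. (\<lambda>N. Z N a) \<longlonglongrightarrow> z a" for z Z
      unfolding hs using that r by (intro trunc_lsc) auto
  qed
  also have "\<dots> = ennreal c * enn_powr S (1 / s)"
    by (simp only: hs S_def c(2) mult.assoc[symmetric])
  also have "\<dots> = ennreal (c * \<sigma> powr (1 / s))"
    using \<sigma> c by (simp add: ennreal_mult)
  finally have le: "\<sigma> \<le> c * \<sigma> powr (1 / s)" using \<sigma> c by (simp add: ennreal_le_iff)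
  have "\<sigma> \<le> c powr r"
  proof (cases "\<sigma> = 0")
    case False
    then have pos: "0 < \<sigma>" using \<sigma> by simp
    have "\<sigma> powr (1 / r) * \<sigma> powr (1 / s) = \<sigma>"
      using pos s(2) by (simp add: powr_add[symmetric])
    then have "\<sigma> powr (1 / r) * \<sigma> powr (1 / s) \<le> c * \<sigma> powr (1 / s)" using le by simp
    then have "\<sigma> powr (1 / r) \<le> c" using pos by simp
    then have "(\<sigma> powr (1 / r)) powr r \<le> c powr r" using r by (intro powr_mono2) auto
    then show ?thesis using pos r by (simp add: powr_powr)
  qed simp
  then show ?thesis using \<sigma> by (simp add: S_def[symmetric] ennreal_leI)
qed

text \<open>For each fixed point, box and cap eventually stop interfering with any given finite
  level below \<open>marginal y\<close>. Arguing by levels also covers the points where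
  \<open>marginal y\<close> is \<infinity>.\<close>

lemma marginal_powr_le_liminf:
  "enn_powr (marginal y) r \<le> liminf (\<lambda>N. ennreal (trunc N y powr r))"
  unfolding le_Liminf_iff
proof (intro allI impI)
  fix c :: ennreal assume c: "c < enn_powr (marginal y) r"
  then obtain c' where c': "c = ennreal c'" "0 \<le> c'" by (cases c) auto
  define d where "d = c' powr (1 / r)"
  have d: "0 \<le> d" "c' = d powr r" using c' r by (simp_all add: d_def powr_powr)
  have "ennreal d < marginal y"
  proof (rule ccontr)
    assume "\<not> ennreal d < marginal y"
    then have "enn_powr (marginal y) r \<le> enn_powr (ennreal d) r"
      using r by (intro enn_powr_mono) auto
    then show False using c c' d by simp
  qed
  obtain N0 :: nat where N0: "d < real N0" by (rule reals_Archimedean2[of d, THEN exE])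
  \<comment> \<open>The sum of the absolute values bounds all coordinates at once, also when there
    are none.\<close>
  obtain N1 :: nat where N1: "(\<Sum>a\<in>{n..<m}. \<bar>y a\<bar>) < real N1"
    by (rule reals_Archimedean2[of "\<Sum>a\<in>{n..<m}. \<bar>y a\<bar>", THEN exE])
  show "\<forall>\<^sub>F N in sequentially. c < ennreal (trunc N y powr r)"
    using eventually_ge_at_top[of "max N0 N1"]
  proof eventually_elim
    case (elim N)
    have "\<bar>y a\<bar> < real N" if "a \<in> {n..<m}" for a
    proof -
      have "\<bar>y a\<bar> \<le> (\<Sum>a\<in>{n..<m}. \<bar>y a\<bar>)" using that by (intro member_le_sum) auto
      then show ?thesis using N1 elim by simp
    qed
    then have "d < trunc N y"
      using trunc_greater[OF d(1), of y N] \<open>ennreal d < marginal y\<close> N0 elim by simp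
    then have "d powr r < trunc N y powr r" using d r by (intro powr_less_mono2) auto
    then show ?case using c' d by (simp add: ennreal_less_iff)
  qed
qed

text \<open>The bound for the truncations does not depend on \<open>N\<close>, so Fatou's lemma
  transfers it to \<open>marginal\<close>. An infinite right side is set aside, since a finite
  \<open>c\<close> is needed to cancel.\<close>

lemma marginal_norm_le:
  "enn_powr (\<integral>\<^sup>+y. enn_powr (marginal y) r \<partial>leb {n..<m}) (1 / r) \<le> ennreal (D powr (- 1 / s)) * rhs"
proof (cases "rhs * ennreal (D powr (- 1 / s)) = top_class.top")
  case True
  then show ?thesis by (simp add: mult.commute)
next
  case False
  then obtain c where c: "0 \<le> c" "rhs * ennreal (D powr (- 1 / s)) = ennreal c"
    by (cases "rhs * ennreal (D powr (- 1 / s))") auto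
  have "(\<integral>\<^sup>+y. enn_powr (marginal y) r \<partial>leb {n..<m}) \<le>
      (\<integral>\<^sup>+y. liminf (\<lambda>N. ennreal (trunc N y powr r)) \<partial>leb {n..<m})"
    by (intro nn_integral_mono marginal_powr_le_liminf)
  also have "\<dots> \<le> liminf (\<lambda>N. \<integral>\<^sup>+y. ennreal (trunc N y powr r) \<partial>leb {n..<m})"
    by (rule nn_integral_liminf) measurable
  also have "\<dots> \<le> liminf (\<lambda>N::nat. ennreal (c powr r))"
    by (intro Liminf_mono always_eventually allI trunc_norm_le c)
  also have "\<dots> = ennreal (c powr r)" by (rule Liminf_const) simp
  finally have "enn_powr (\<integral>\<^sup>+y. enn_powr (marginal y) r \<partial>leb {n..<m}) (1 / r) \<le> enn_powr (ennreal (c powr r)) (1 / r)"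
    using r by (intro enn_powr_mono) auto
  also have "\<dots> = ennreal c" using c r by (simp add: powr_powr)
  finally show ?thesis using c by (simp add: mult.commute)
qed

end

theorem theorem7:
  fixes m n :: nat and V :: "real Matrix.mat" and r D :: real
    and p :: "nat \<Rightarrow> real" and f F :: "nat \<Rightarrow> real \<Rightarrow> real"
  assumes nm: "n \<le> m"
    and V: "V \<in> carrier_mat m m" "V * transpose_mat V = 1\<^sub>m m"
    and r: "r > 1"
    and p: "\<forall>i<m. p i > 1"
    and psum: "(\<Sum>i<m. 1 / p i) = real n + (real m - real n) / r"
    and D: "best_const m n V r p D"
    and f: "\<forall>i<m. continuous_on UNIV (f i) \<and> (\<forall>t. f i t > 0) \<and> integrable lborel (f i)"
    and F: "\<forall>i<m. continuous_on UNIV (F i) \<and> (\<forall>t. F i t > 0) \<and> integrable lborel (F i)"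
    and same: "\<forall>i<m. integral\<^sup>L lborel (f i) = integral\<^sup>L lborel (F i)"
  shows "enn_powr
           (\<integral>\<^sup>+ y. enn_powr
              (\<integral>\<^sup>+ x. ennreal (\<Prod>i<m. f i (ip_row m V i (glue n x y)) powr (1 / p i))
                 \<partial>(PiM {..<n} (\<lambda>_. lborel))) r
            \<partial>(PiM {n..<m} (\<lambda>_. lborel))) (1 / r)
         \<le> (if D = 0 then \<infinity> else
              ennreal (D powr (- 1 / conj_exp r)) *
              (\<integral>\<^sup>+ X. enn_powr
                 (\<integral>\<^sup>+ Y. ennreal (\<Prod>i<m. F i (ip_row m V i (glue n X Y)) powr (r / p i))
                    \<partial>(PiM {n..<m} (\<lambda>_. lborel))) (1 / r)
               \<partial>(PiM {..<n} (\<lambda>_. lborel))))"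
proof (cases "D = 0")
  case False
  with D have D': "0 < D" "det_ineq m n V r p D" by (auto simp: best_const_def)
  \<comment> \<open>The condition \<open>i < m\<close> stands inside the existential quantifier, so
    that \<open>choice\<close> yields one function on all indices.\<close>
  have "\<forall>i. \<exists>u. i < m \<longrightarrow> strict_mono u \<and> surj u \<and> (\<forall>t. (u has_real_derivative F i t / f i (u t)) (at t))"
  proof
    fix i
    show "\<exists>u. i < m \<longrightarrow> strict_mono u \<and> surj u \<and> (\<forall>t. (u has_real_derivative F i t / f i (u t)) (at t))"
    proof (cases "i < m")
      case True
      have "\<exists>u. strict_mono u \<and> surj u \<and> (\<forall>t. (u has_real_derivative F i t / f i (u t)) (at t))"
        by (rule monotone_transport) (use f F same True in simp_all)
      then show ?thesis by (rule ex_forward) simp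
    qed simp
  qed
  from choice[OF this] obtain u where u: "\<forall>i. i < m \<longrightarrow> strict_mono (u i) \<and> surj (u i) \<and>
      (\<forall>t. (u i has_real_derivative F i t / f i (u i t)) (at t))" ..
  \<comment> \<open>The derivative is supplied as the quotient itself, so the locale's formula for
    \<open>u'\<close> holds by reflexivity.\<close>
  interpret young_transport m n V r D p f F u "\<lambda>i t. F i t / f i (u i t)"
    by unfold_locales (use nm V r p D' f F u in simp_all)
  have "rhs = (\<integral>\<^sup>+ X. enn_powr
      (\<integral>\<^sup>+ Y. ennreal (\<Prod>i<m. F i (ip_row m V i (glue n X Y)) powr (r / p i)) \<partial>leb {n..<m}) (1 / r) \<partial>leb {..<n})"
    by (simp add: rhs_def weight_def rot_def prod_powr_distrib powr_powr)
  moreover have "marginal y = (\<integral>\<^sup>+ x. ennreal (\<Prod>i<m. f i (ip_row m V i (glue n x y)) powr (1 / p i)) \<partial>leb {..<n})" for y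
    by (simp add: marginal_def weight_def rot_def)
  ultimately show ?thesis
    using marginal_norm_le False by (simp add: s_def)
qed simp

end
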